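(* Let $Q=(Q_{ij})$ and $\tilde Q$ be irreducible, conservative, uniformly bounded intensity matrices on a countable state space $\mathbb{E}$, let $\Phi(t)$ and $\tilde\Phi(t)$ be the corresponding continuous-time Markov chains, and let $\Delta=\tilde Q-Q$. Assume $\Phi(t)$ is positive recurrent with unique invariant probability measure $\pi$. Let $i_0$ be any fixed state in $\mathbb{E}$. Suppose there are a finite function $V$ on $\mathbb{E}$ bounded away from zero (i.e. $\inf_{i\in\mathbb{E}}V(i)>0$) and positive constants $\lambda,b<\infty$ such that $$\sum_{j\in\mathbb{E}}Q_{ij}V(j)\le-\lambda V(i)+b\,I_{\{i_0\}}(i),\qquad i\in\mathbb{E}.$$ (i) Let $c=1+\|e\|_V\|\pi\|_V$. If $\|\Delta\|_V<\frac{\lambda}{c}$, then $\tilde\Phi(t)$ is positive recurrent, and its unique invariant probability measure $\nu$ satisfies $$\|\nu-\pi\|_V\le\frac{c\,\|\pi\|_V\,\|\Delta\|_V}{\lambda-c\|\Delta\|_V}.$$ (ii) Assume $\tilde\Phi(t)$ is positive recurrent with unique invariant probability measure $\nu$. If $V\ge1$ and $\|\Delta\|_V<\frac{\lambda^2}{b+\lambda}$, then $$\|\nu-\pi\|_V\le\frac{b(b+\lambda)\|\Delta\|_V}{\lambda^3-\lambda(b+\lambda)\|\Delta\|_V}.$$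
   Context: An intensity matrix $Q$ has $Q_{ij}\ge 0$ for $i\ne j$; it is conservative if all row sums are zero, and uniformly bounded if $\sup_{i\in\mathbb{E}}(-Q_{ii})<\infty$. The chain associated with $Q$ has transition function $P^t=e^{Qt}=\sum_{n\ge0}(Qt)^n/n!$. $e$ is the column vector of all ones and $I_{\{i_0\}}$ is the indicator function of $\{i_0\}$. For a function $V$ on $\mathbb{E}$ with $\inf V>0$, the $V$-norms are: for a (signed) measure $\mu$, $\|\mu\|_V=\sum_{i\in\mathbb{E}}|\mu(i)|V(i)$; for a column vector $x$, $\|x\|_V=\sup_{i\in\mathbb{E}}|x(i)|/V(i)$; for a matrix $L=(L_{ij})$ on $\mathbb{E}\times\mathbb{E}$, $\|L\|_V=\sup_{i\in\mathbb{E}}\frac{1}{V(i)}\sum_{j\in\mathbb{E}}|L_{ij}|V(j)$. *)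

theory Defs
  imports "HOL-Probability.Probability"
begin

text \<open>
  The countable state space is a type of class \<open>countable\<close> (finite or infinite).  Matrices are
  functions \<open>'a \<Rightarrow> 'a \<Rightarrow> real\<close>, and probability measures on the state space are values of type
  \<open>'a pmf\<close>.
\<close>

definition intensity_matrix :: "('a \<Rightarrow> 'a \<Rightarrow> real) \<Rightarrow> bool" where
  "intensity_matrix Q \<longleftrightarrow> (\<forall>i j. i \<noteq> j \<longrightarrow> 0 \<le> Q i j)"

definition conservative :: "('a \<Rightarrow> 'a \<Rightarrow> real) \<Rightarrow> bool" where
  "conservative Q \<longleftrightarrow> (\<forall>i. ((\<lambda>j. Q i j) has_sum 0) UNIV)"

definition uniformly_bounded :: "('a \<Rightarrow> 'a \<Rightarrow> real) \<Rightarrow> bool" where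
  "uniformly_bounded Q \<longleftrightarrow> bdd_above (range (\<lambda>i. - Q i i))"

definition irreducible_matrix :: "('a \<Rightarrow> 'a \<Rightarrow> real) \<Rightarrow> bool" where
  "irreducible_matrix Q \<longleftrightarrow> (\<forall>i j. (i, j) \<in> {(k, l). k \<noteq> l \<and> Q k l > 0}\<^sup>*)"

text \<open>
  For a conservative, uniformly bounded intensity matrix all the sums in the next two definitions
  converge absolutely.
\<close>

primrec matrix_power :: "('a \<Rightarrow> 'a \<Rightarrow> real) \<Rightarrow> nat \<Rightarrow> 'a \<Rightarrow> 'a \<Rightarrow> real" where
  "matrix_power L 0 = (\<lambda>i j. if i = j then 1 else 0)"
| "matrix_power L (Suc n) = (\<lambda>i j. \<Sum>\<^sub>\<infinity>k\<in>UNIV. matrix_power L n i k * L k j)"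

definition transition_function :: "('a \<Rightarrow> 'a \<Rightarrow> real) \<Rightarrow> real \<Rightarrow> 'a \<Rightarrow> 'a \<Rightarrow> real" where
  "transition_function Q t i j = (\<Sum>n. matrix_power (\<lambda>k l. Q k l * t) n i j / fact n)"

text \<open>
  \<open>(P, X)\<close> realises the continuous-time Markov chain with transition function \<open>exp (Q t)\<close>: \<open>P i\<close>
  is the law under which the chain starts in \<open>i\<close>, and the paths are right-continuous for the
  discrete topology.  The last conjunct is the time-homogeneous Markov property
  \<open>P\<^sub>i (X u = j | X (t 0) = s 0, \<dots>, X (t n) = s n) = exp (Q (u - t n)) (s n) j\<close>
  multiplied out.  Only times \<open>\<ge> 0\<close> matter.
\<close>

definition markov_chain ::
    "('a \<Rightarrow> 'a \<Rightarrow> real) \<Rightarrow> ('a \<Rightarrow> 'w measure) \<Rightarrow> (real \<Rightarrow> 'w \<Rightarrow> 'a) \<Rightarrow> bool" where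
  "markov_chain Q P X \<longleftrightarrow>
     (\<forall>i. prob_space (P i)) \<and>
     (\<forall>i. \<forall>t\<ge>0. X t \<in> measurable (P i) (count_space UNIV)) \<and>
     (\<forall>i. \<forall>\<omega>\<in>space (P i). \<forall>t\<ge>0. eventually (\<lambda>s. X s \<omega> = X t \<omega>) (at_right t)) \<and>
     (\<forall>i. measure (P i) {\<omega>\<in>space (P i). X 0 \<omega> = i} = 1) \<and>
     (\<forall>i (n::nat) (t::nat \<Rightarrow> real) s u j.
        0 \<le> t 0 \<longrightarrow> (\<forall>k<n. t k < t (Suc k)) \<longrightarrow> t n < u \<longrightarrow>
        measure (P i) {\<omega>\<in>space (P i). (\<forall>k\<le>n. X (t k) \<omega> = s k) \<and> X u \<omega> = j} =
        measure (P i) {\<omega>\<in>space (P i). \<forall>k\<le>n. X (t k) \<omega> = s k} *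
          transition_function Q (u - t n) (s n) j)"

definition first_jump_time :: "(real \<Rightarrow> 'w \<Rightarrow> 'a) \<Rightarrow> 'w \<Rightarrow> ennreal" where
  "first_jump_time X \<omega> = (INF t\<in>{t. 0 \<le> t \<and> X t \<omega> \<noteq> X 0 \<omega>}. ennreal t)"

definition return_time :: "(real \<Rightarrow> 'w \<Rightarrow> 'a) \<Rightarrow> 'a \<Rightarrow> 'w \<Rightarrow> ennreal" where
  "return_time X i \<omega> =
     (INF t\<in>{t. 0 \<le> t \<and> first_jump_time X \<omega> \<le> ennreal t \<and> X t \<omega> = i}. ennreal t)"

text \<open>
  Positive recurrence in the usual sense of finite mean return times.  As usual an absorbing state
  (\<open>Q i i = 0\<close>), which is never left and hence never returned to, counts as positive recurrent; for
  irreducible \<open>Q\<close> this concerns only the one-point state space.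
\<close>

definition positive_recurrent ::
    "('a \<Rightarrow> 'a \<Rightarrow> real) \<Rightarrow> ('a \<Rightarrow> 'w measure) \<Rightarrow> (real \<Rightarrow> 'w \<Rightarrow> 'a) \<Rightarrow> bool" where
  "positive_recurrent Q P X \<longleftrightarrow>
     (\<forall>i. Q i i = 0 \<or> (\<integral>\<^sup>+\<omega>. return_time X i \<omega> \<partial>P i) < \<infinity>)"

definition invariant_prob :: "('a \<Rightarrow> 'a \<Rightarrow> real) \<Rightarrow> 'a pmf \<Rightarrow> bool" where
  "invariant_prob Q \<mu> \<longleftrightarrow>
     (\<forall>t\<ge>0. \<forall>j. ((\<lambda>i. pmf \<mu> i * transition_function Q t i j) has_sum pmf \<mu> j) UNIV)"

definition unique_invariant_prob :: "('a \<Rightarrow> 'a \<Rightarrow> real) \<Rightarrow> 'a pmf \<Rightarrow> bool" where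
  "unique_invariant_prob Q \<mu> \<longleftrightarrow>
     invariant_prob Q \<mu> \<and> (\<forall>\<mu>'. invariant_prob Q \<mu>' \<longrightarrow> \<mu>' = \<mu>)"

text \<open>The \<open>V\<close>-norms take values in \<open>[0, \<infinity>]\<close>; they are meant for \<open>V > 0\<close>.\<close>

definition measure_norm :: "('a \<Rightarrow> real) \<Rightarrow> ('a \<Rightarrow> real) \<Rightarrow> ennreal" where
  "measure_norm V \<mu> = (\<Sum>\<^sub>\<infinity>i\<in>UNIV. ennreal (\<bar>\<mu> i\<bar> * V i))"

definition vector_norm :: "('a \<Rightarrow> real) \<Rightarrow> ('a \<Rightarrow> real) \<Rightarrow> ennreal" where
  "vector_norm V x = (SUP i. ennreal (\<bar>x i\<bar> / V i))"

definition matrix_norm :: "('a \<Rightarrow> real) \<Rightarrow> ('a \<Rightarrow> 'a \<Rightarrow> real) \<Rightarrow> ennreal" where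
  "matrix_norm V L =
     (SUP i. ennreal (1 / V i) * (\<Sum>\<^sub>\<infinity>j\<in>UNIV. ennreal (\<bar>L i j\<bar> * V j)))"

text \<open>
  The sum of \<open>Q i j * V j\<close> over \<open>j\<close> has at most one negative term, so it always exists in
  \<open>(-\<infinity>, \<infinity>]\<close>, and a finite upper bound on it includes its convergence; since \<open>infsum\<close> is \<open>0\<close> for
  divergent sums, convergence has to be stated separately.
\<close>

definition drift_condition ::
    "('a \<Rightarrow> 'a \<Rightarrow> real) \<Rightarrow> ('a \<Rightarrow> real) \<Rightarrow> real \<Rightarrow> real \<Rightarrow> 'a \<Rightarrow> bool" where
  "drift_condition Q V lam b i0 \<longleftrightarrow>
     (\<forall>i. (\<lambda>j. Q i j * V j) summable_on UNIV \<and>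
          (\<Sum>\<^sub>\<infinity>j\<in>UNIV. Q i j * V j) \<le> - lam * V i + b * indicator {i0} i)"

end

theory Submission
  imports Defs
begin

text \<open>
  Write \<open>P = I + Q / h\<close> with \<open>h\<close> large (uniformization).  Then \<open>\<pi> exp (Q t) = \<pi>\<close> for all \<open>t\<close> is
  equivalent to \<open>\<pi> Q = 0\<close> and to \<open>\<pi> P = \<pi>\<close>.  If \<open>\<nu> Q' = 0\<close>, then \<open>\<nu> - \<pi>\<close> satisfies
  \<open>(\<nu> - \<pi>) Q = - \<nu> \<Delta>\<close>.  Subtracting the multiple \<open>t \<pi>\<close> that makes \<open>m = \<nu> - \<pi> - t \<pi>\<close> vanish at
  \<open>i0\<close>, one has \<open>\<bar>m\<bar> \<le> \<bar>m\<bar> P + \<nu> \<bar>\<Delta>\<bar> / h\<close>; integrating \<open>V\<close> and using the drift condition, whose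
  additive term is invisible to \<open>m\<close>, gives \<open>lam \<parallel>m\<parallel> \<le> \<parallel>\<nu>\<parallel> \<parallel>\<Delta>\<parallel>\<close>.  Since \<open>m\<close> has total mass \<open>- t\<close>, this yields
  \<open>lam \<parallel>\<nu> - \<pi>\<parallel> \<le> c \<parallel>\<Delta>\<parallel> \<parallel>\<nu>\<parallel> \<le> c \<parallel>\<Delta>\<parallel> (\<parallel>\<nu> - \<pi>\<parallel> + \<parallel>\<pi>\<parallel>)\<close>, which is the bound in (i); the bound in (ii)
  follows from \<open>\<parallel>\<pi>\<parallel> \<le> b / lam\<close>.

  The perturbed matrix satisfies the drift condition with \<open>lam - \<parallel>\<Delta>\<parallel>\<close> in place of \<open>lam\<close>.  Hence an
  excursion from \<open>i0\<close> of its uniformized chain has finite expected length, which provides \<open>\<nu>\<close>; it is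
  unique by the estimate above with \<open>\<Delta> = 0\<close>.  Positive recurrence follows from \<open>\<nu>\<close> by Kac's
  argument for the chain observed at the times \<open>0, d, 2 d, \<dots>\<close>.
\<close>

section \<open>Sums over a countable type\<close>

abbreviation counting :: "'a measure" where
  "counting \<equiv> count_space UNIV"

text \<open>Both sides are suprema of sums over finite sets; an enumeration of the countable type
  turns these sets into an increasing sequence, to which monotone convergence applies. This carries
  the norms over to the integral calculus used below.\<close>

lemma infsum_ennreal_eq_nn_integral:
  fixes f :: "'a::countable \<Rightarrow> ennreal"
  shows "(\<Sum>\<^sub>\<infinity>i\<in>UNIV. f i) = (\<integral>\<^sup>+i. f i \<partial>counting)"
proof (rule antisym)
  have sum_eq: "sum f F = (\<integral>\<^sup>+i. f i * indicator F i \<partial>counting)" if "finite F" for F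
  proof -
    have "(\<integral>\<^sup>+i. f i * indicator F i \<partial>counting) = (\<Sum>i\<in>F. f i * indicator F i)"
      by (rule nn_integral_count_space') (use that in auto)
    then show ?thesis by (simp add: indicator_def)
  qed
  have "sum f F \<le> (\<integral>\<^sup>+i. f i \<partial>counting)" if "finite F" for F
    unfolding sum_eq[OF that] by (intro nn_integral_mono) (auto simp: indicator_def)
  then show "(\<Sum>\<^sub>\<infinity>i\<in>UNIV. f i) \<le> (\<integral>\<^sup>+i. f i \<partial>counting)"
    by (subst nonneg_infsum_complete) (auto intro!: SUP_least)
  define F :: "nat \<Rightarrow> 'a set" where "F n = {i. to_nat i < n}" for n
  have finF: "finite (F n)" for n
    unfolding F_def by (rule finite_imageD[of to_nat]) (auto intro: finite_subset[of _ "{..<n}"])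
  have "(\<integral>\<^sup>+i. f i \<partial>counting) = (\<integral>\<^sup>+i. (SUP n. f i * indicator (F n) i) \<partial>counting)"
  proof (intro nn_integral_cong antisym)
    fix i
    have "f i = f i * indicator (F (Suc (to_nat i))) i" by (simp add: F_def)
    also have "\<dots> \<le> (SUP n. f i * indicator (F n) i)" by (rule SUP_upper) simp
    finally show "f i \<le> (SUP n. f i * indicator (F n) i)" .
  qed (auto intro!: SUP_least simp: indicator_def)
  also have "\<dots> = (SUP n. \<integral>\<^sup>+i. f i * indicator (F n) i \<partial>counting)"
    by (intro nn_integral_monotone_convergence_SUP)
       (auto simp: incseq_def le_fun_def F_def indicator_def)
  also have "\<dots> = (SUP n. sum f (F n))"
    using sum_eq finF by simp
  also have "\<dots> \<le> (\<Sum>\<^sub>\<infinity>i\<in>UNIV. f i)"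
    by (subst nonneg_infsum_complete) (auto intro!: SUP_mono finF)
  finally show "(\<integral>\<^sup>+i. f i \<partial>counting) \<le> (\<Sum>\<^sub>\<infinity>i\<in>UNIV. f i)" .
qed

lemma summable_on_iff_integrable_counting:
  fixes f :: "'a \<Rightarrow> real"
  shows "f summable_on UNIV \<longleftrightarrow> integrable counting f"
  by (metis summable_on_iff_abs_summable_on_real abs_summable_equivalent abs_summable_on_def)

lemma infsum_eq_integral_counting:
  fixes f :: "'a \<Rightarrow> real"
  shows "(\<Sum>\<^sub>\<infinity>i\<in>UNIV. f i) = (\<integral>i. f i \<partial>counting)"
proof (cases "f summable_on UNIV")
  case True
  then show ?thesis
    by (metis infsetsum_infsum infsetsum_def abs_summable_equivalent summable_on_iff_abs_summable_on_real)
next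
  case False
  then show ?thesis
    by (simp add: infsum_not_exists summable_on_iff_integrable_counting not_integrable_integral_eq)
qed

lemma has_sum_iff_counting:
  fixes f :: "'a \<Rightarrow> real"
  shows "(f has_sum s) UNIV \<longleftrightarrow> integrable counting f \<and> (\<integral>i. f i \<partial>counting) = s"
  by (metis has_sum_infsum has_sum_imp_summable infsumI infsum_eq_integral_counting
      summable_on_iff_integrable_counting)

text \<open>In the non-integrable case the Bochner integral has the default value 0 and the
  inequality is trivial.\<close>

lemma abs_integral_counting_le:
  fixes f :: "'a \<Rightarrow> real"
  shows "ennreal \<bar>\<integral>i. f i \<partial>counting\<bar> \<le> (\<integral>\<^sup>+i. ennreal \<bar>f i\<bar> \<partial>counting)"
proof (cases "integrable counting f")
  case True
  then show ?thesis using integral_norm_bound_ennreal[of counting f] by simp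
qed (simp add: not_integrable_integral_eq)

lemma nn_integral_counting_swap:
  fixes f :: "'a::countable \<Rightarrow> 'b \<Rightarrow> ennreal"
  shows "(\<integral>\<^sup>+i. \<integral>\<^sup>+j. f i j \<partial>counting \<partial>counting) = (\<integral>\<^sup>+j. \<integral>\<^sup>+i. f i j \<partial>counting \<partial>counting)"
  by (rule nn_integral_count_space_nn_integral[symmetric]) auto

text \<open>Fubini for signed double series: by countability the product of the counting measures is
  again a counting measure, so absolute summability is integrability on the product.\<close>

lemma integral_counting_swap:
  fixes f :: "'a::countable \<Rightarrow> 'b::countable \<Rightarrow> real"
  assumes fin: "(\<integral>\<^sup>+i. \<integral>\<^sup>+j. ennreal \<bar>f i j\<bar> \<partial>counting \<partial>counting) < \<infinity>"
  shows "(\<integral>i. \<integral>j. f i j \<partial>counting \<partial>counting) = (\<integral>j. \<integral>i. f i j \<partial>counting \<partial>counting)"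
proof -
  interpret pair_sigma_finite "counting :: 'a measure" "counting :: 'b measure"
    by (simp add: pair_sigma_finite_def sigma_finite_measure_count_space)
  have prod: "(counting :: 'a measure) \<Otimes>\<^sub>M (counting :: 'b measure) = counting"
    by (simp add: pair_measure_countable)
  have "(\<integral>\<^sup>+z. ennreal (norm (case_prod f z)) \<partial>(counting \<Otimes>\<^sub>M counting))
      = (\<integral>\<^sup>+i. \<integral>\<^sup>+j. ennreal \<bar>f i j\<bar> \<partial>counting \<partial>counting)"
    by (subst M2.nn_integral_fst[symmetric]) (auto simp: prod)
  then have "integrable (counting \<Otimes>\<^sub>M counting) (case_prod f)"
    using fin by (intro integrableI_bounded) (auto simp: prod)
  from Fubini_integral[OF this] show ?thesis by simp
qed

lemma nn_integral_counting_single: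
  "(\<integral>\<^sup>+j. (if j = i then f j else 0) \<partial>counting) = (f i :: ennreal)"
  "(\<integral>\<^sup>+j. (if i = j then f j else 0) \<partial>counting) = (f i :: ennreal)"
proof -
  show "(\<integral>\<^sup>+j. (if j = i then f j else 0) \<partial>counting) = (f i :: ennreal)"
    by (subst nn_integral_count_space'[of "{i}"]) auto
  then show "(\<integral>\<^sup>+j. (if i = j then f j else 0) \<partial>counting) = (f i :: ennreal)"
    by (simp add: eq_commute)
qed

lemma integrable_counting_iff:
  fixes f :: "'a \<Rightarrow> real"
  shows "integrable counting f \<longleftrightarrow> (\<integral>\<^sup>+i. ennreal \<bar>f i\<bar> \<partial>counting) < \<infinity>"
  by (simp add: integrable_iff_bounded)

lemma term_le_nn_integral_counting:
  fixes f :: "'a \<Rightarrow> ennreal"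
  shows "f i \<le> (\<integral>\<^sup>+j. f j \<partial>counting)"
proof -
  have "f i = (\<integral>\<^sup>+j. (if j = i then f j else 0) \<partial>counting)"
    by (simp add: nn_integral_counting_single)
  also have "\<dots> \<le> (\<integral>\<^sup>+j. f j \<partial>counting)"
    by (intro nn_integral_mono) auto
  finally show ?thesis .
qed

section \<open>The transition function\<close>

lemma matrix_power_Suc_integral:
  "matrix_power A (Suc n) i j = (\<integral>k. matrix_power A n i k * A k j \<partial>counting)"
  by (simp add: infsum_eq_integral_counting)

text \<open>The supremum of the absolute row sums is a submultiplicative norm, as Tonelli shows by
  summing over the last index first.\<close>

lemma matrix_power_row_sum_le:
  fixes A :: "'a::countable \<Rightarrow> 'a \<Rightarrow> real"
  assumes A: "\<And>i. (\<integral>\<^sup>+j. ennreal \<bar>A i j\<bar> \<partial>counting) \<le> ennreal C" and C: "0 \<le> C"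
  shows "(\<integral>\<^sup>+j. ennreal \<bar>matrix_power A n i j\<bar> \<partial>counting) \<le> ennreal (C ^ n)"
proof (induction n)
  case 0
  have "(\<integral>\<^sup>+j. ennreal \<bar>matrix_power A 0 i j\<bar> \<partial>counting) = (\<integral>\<^sup>+j. (if i = j then 1 else 0) \<partial>counting)"
    by (intro nn_integral_cong) auto
  then show ?case by (simp add: nn_integral_counting_single)
next
  case (Suc n)
  have "(\<integral>\<^sup>+j. ennreal \<bar>matrix_power A (Suc n) i j\<bar> \<partial>counting)
      \<le> (\<integral>\<^sup>+j. \<integral>\<^sup>+k. ennreal \<bar>matrix_power A n i k\<bar> * ennreal \<bar>A k j\<bar> \<partial>counting \<partial>counting)"
    unfolding matrix_power_Suc_integral
    by (intro nn_integral_mono order_trans[OF abs_integral_counting_le]) (simp add: abs_mult ennreal_mult)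
  also have "\<dots> = (\<integral>\<^sup>+k. ennreal \<bar>matrix_power A n i k\<bar> * (\<integral>\<^sup>+j. ennreal \<bar>A k j\<bar> \<partial>counting) \<partial>counting)"
    by (subst nn_integral_counting_swap) (simp add: nn_integral_cmult)
  also have "\<dots> \<le> (\<integral>\<^sup>+k. ennreal \<bar>matrix_power A n i k\<bar> * ennreal C \<partial>counting)"
    by (intro nn_integral_mono mult_left_mono A) simp
  also have "\<dots> = (\<integral>\<^sup>+k. ennreal \<bar>matrix_power A n i k\<bar> \<partial>counting) * ennreal C"
    by (simp add: nn_integral_multc)
  also have "\<dots> \<le> ennreal (C ^ n) * ennreal C"
    by (intro mult_right_mono Suc) simp
  finally show ?case using C by (simp add: ennreal_mult' mult.commute)
qed

lemma abs_matrix_power_le: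
  fixes A :: "'a::countable \<Rightarrow> 'a \<Rightarrow> real"
  assumes A: "\<And>i. (\<integral>\<^sup>+j. ennreal \<bar>A i j\<bar> \<partial>counting) \<le> ennreal C" and C: "0 \<le> C"
  shows "\<bar>matrix_power A n i j\<bar> \<le> C ^ n"
proof -
  have "ennreal \<bar>matrix_power A n i j\<bar> \<le> ennreal (C ^ n)"
    using term_le_nn_integral_counting[of "\<lambda>j. ennreal \<bar>matrix_power A n i j\<bar>" j]
      matrix_power_row_sum_le[OF A C] by (rule order_trans)
  then show ?thesis using C by (simp add: ennreal_le_iff)
qed

lemma matrix_power_1:
  fixes A :: "'a::countable \<Rightarrow> 'a \<Rightarrow> real"
  shows "matrix_power A (Suc 0) i j = A i j"
proof -
  have "matrix_power A (Suc 0) i j = (\<Sum>\<^sub>\<infinity>k\<in>UNIV. if k = i then A i j else 0)"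
    by (auto intro!: infsum_cong)
  also have "\<dots> = (\<Sum>\<^sub>\<infinity>k\<in>{i}. if k = i then A i j else 0)"
    by (rule infsum_cong_neutral) auto
  finally show ?thesis by simp
qed

lemma transition_function_summable:
  fixes A :: "'a::countable \<Rightarrow> 'a \<Rightarrow> real"
  assumes A: "\<And>i. (\<integral>\<^sup>+j. ennreal \<bar>A i j\<bar> \<partial>counting) \<le> ennreal C" and C: "0 \<le> C"
  shows "summable (\<lambda>n. \<bar>matrix_power A n i j / fact n\<bar>)"
proof (rule summable_comparison_test'[of "\<lambda>n. C ^ n / fact n" 0])
  show "summable (\<lambda>n. C ^ n / fact n)"
    using summable_exp_generic[of C] by (simp add: field_simps)
qed (use abs_matrix_power_le[OF A C] in \<open>auto simp: divide_right_mono\<close>)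

lemma scaled_row_sum_le:
  assumes "(\<integral>\<^sup>+j. ennreal \<bar>Q i j\<bar> \<partial>counting) \<le> ennreal C" and "0 \<le> C" "0 \<le> t"
  shows "(\<integral>\<^sup>+j. ennreal \<bar>Q i j * t\<bar> \<partial>counting) \<le> ennreal (C * t)"
proof -
  have "(\<integral>\<^sup>+j. ennreal \<bar>Q i j * t\<bar> \<partial>counting) = (\<integral>\<^sup>+j. ennreal \<bar>Q i j\<bar> \<partial>counting) * ennreal t"
    using assms by (simp add: abs_mult ennreal_mult nn_integral_multc)
  also have "\<dots> \<le> ennreal C * ennreal t"
    by (intro mult_right_mono assms) simp
  finally show ?thesis using assms by (simp add: ennreal_mult)
qed

text \<open>What remains of the exponential series after its first two terms is at most (C t)^2
  times the series for exp C. The bound does not depend on \<open>i\<close> and \<open>j\<close>, so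
  it can be integrated against a probability measure.\<close>

lemma transition_function_near_identity:
  fixes Q :: "'a::countable \<Rightarrow> 'a \<Rightarrow> real"
  assumes Q: "\<And>i. (\<integral>\<^sup>+j. ennreal \<bar>Q i j\<bar> \<partial>counting) \<le> ennreal C" and C: "0 \<le> C"
    and t: "0 \<le> t" "t \<le> 1"
  shows "\<bar>transition_function Q t i j - (if i = j then 1 else 0) - t * Q i j\<bar> \<le> t\<^sup>2 * (C\<^sup>2 * exp C)"
proof -
  define A where "A = (\<lambda>k l. Q k l * t)"
  have A: "(\<integral>\<^sup>+j. ennreal \<bar>A i j\<bar> \<partial>counting) \<le> ennreal (C * t)" for i
    unfolding A_def using C t by (intro scaled_row_sum_le Q) auto
  have Ct: "0 \<le> C * t" "C * t \<le> C" using C t by (auto simp: mult_left_le)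
  define f where "f n = matrix_power A n i j / fact n" for n
  have sumf: "summable (\<lambda>n. \<bar>f n\<bar>)"
    unfolding f_def by (rule transition_function_summable[OF A Ct(1)])
  have "transition_function Q t i j = (\<Sum>n. f n)"
    by (simp add: transition_function_def f_def A_def)
  also have "\<dots> = (\<Sum>n. f (n + 2)) + (\<Sum>n<2. f n)"
    by (rule suminf_split_initial_segment) (use sumf summable_rabs_cancel in blast)
  also have "(\<Sum>n<2. f n) = (if i = j then 1 else 0) + t * Q i j"
    using matrix_power_1[of A i j] by (simp add: f_def numeral_2_eq_2 A_def del: matrix_power.simps(2))
  finally have "\<bar>transition_function Q t i j - (if i = j then 1 else 0) - t * Q i j\<bar> = \<bar>\<Sum>n. f (n + 2)\<bar>"
    by simp
  also have sumf2: "summable (\<lambda>n. \<bar>f (n + 2)\<bar>)"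
    using sumf by (rule summable_ignore_initial_segment)
  then have "\<bar>\<Sum>n. f (n + 2)\<bar> \<le> (\<Sum>n. \<bar>f (n + 2)\<bar>)" by (rule summable_rabs)
  also have "\<dots> \<le> (\<Sum>n. (C * t)\<^sup>2 * (C ^ n /\<^sub>R fact n))"
  proof (rule suminf_le)
    fix n
    have "\<bar>f (n + 2)\<bar> \<le> (C * t) ^ (n + 2) / fact (n + 2)"
      unfolding f_def using abs_matrix_power_le[OF A Ct(1), where n = "n + 2" and i = i and j = j]
      by (simp add: divide_right_mono del: matrix_power.simps(2) fact_Suc)
    also have "\<dots> \<le> (C * t) ^ (n + 2) / fact n"
      using Ct by (intro divide_left_mono fact_mono) auto
    also have "\<dots> = (C * t)\<^sup>2 * ((C * t) ^ n /\<^sub>R fact n)"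
      by (simp add: power_add field_simps power2_eq_square)
    also have "\<dots> \<le> (C * t)\<^sup>2 * (C ^ n /\<^sub>R fact n)"
      using Ct by (intro mult_left_mono scaleR_left_mono power_mono) auto
    finally show "\<bar>f (n + 2)\<bar> \<le> (C * t)\<^sup>2 * (C ^ n /\<^sub>R fact n)" .
  qed (use sumf2 summable_exp_generic[of C] in \<open>auto intro: summable_mult\<close>)
  also have "\<dots> = (C * t)\<^sup>2 * exp C"
    using summable_exp_generic[of C] by (simp add: suminf_mult exp_def)
  finally show ?thesis by (simp add: power_mult_distrib mult_ac)
qed

section \<open>Invariant probability measures\<close>

text \<open>The equation \<mu> Q = 0. A non-integrable column would give the default value 0, so the
  definition is used for matrices with bounded entries, whose columns are integrable against a
  \<open>pmf\<close>.\<close>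

definition balanced :: "('a \<Rightarrow> 'a \<Rightarrow> real) \<Rightarrow> 'a pmf \<Rightarrow> bool" where
  "balanced Q \<mu> \<longleftrightarrow> (\<forall>j. (\<integral>i. pmf \<mu> i * Q i j \<partial>counting) = 0)"

lemma integrable_pmf_mult_bounded:
  assumes "\<And>i. \<bar>f i\<bar> \<le> (B::real)"
  shows "integrable counting (\<lambda>i. pmf \<mu> i * f i)"
proof (rule Bochner_Integration.integrable_bound)
  show "integrable counting (\<lambda>i. B * pmf \<mu> i)"
    by (simp add: integrable_pmf)
  show "AE i in counting. norm (pmf \<mu> i * f i) \<le> norm (B * pmf \<mu> i)"
  proof (intro AE_I2)
    fix i
    have "\<bar>f i\<bar> \<le> \<bar>B\<bar>" using assms[of i] by linarith
    then show "norm (pmf \<mu> i * f i) \<le> norm (B * pmf \<mu> i)"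
      using mult_right_mono[of "\<bar>f i\<bar>" "\<bar>B\<bar>" "pmf \<mu> i"] by (simp add: abs_mult mult.commute)
  qed
qed simp

lemma integral_counting_single:
  "integrable counting (\<lambda>i. if i = j then f i else 0 :: real)"
  "(\<integral>i. (if i = j then f i else 0 :: real) \<partial>counting) = f j"
proof -
  have "((\<lambda>i. if i = j then f i else 0) has_sum f j) {j}"
    using has_sum_finite[of "{j}" "\<lambda>i. if i = j then f i else 0"] by simp
  then have "((\<lambda>i. if i = j then f i else 0) has_sum f j) UNIV"
    by (subst has_sum_cong_neutral[where T = "{j}"]) auto
  then show "integrable counting (\<lambda>i. if i = j then f i else 0 :: real)"
    "(\<integral>i. (if i = j then f i else 0 :: real) \<partial>counting) = f j"
    by (simp_all add: has_sum_iff_counting)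
qed

text \<open>The rate \<open>h\<close> is any positive upper bound of the exit rates rather than
  their supremum: a single \<open>h\<close> can then serve two matrices at once and be chosen above
  the drift rate.\<close>

locale bounded_generator =
  fixes Q :: "'a::countable \<Rightarrow> 'a \<Rightarrow> real" and h :: real
  assumes intensity: "intensity_matrix Q" and cons: "conservative Q"
    and h_pos: "0 < h" and diag_le: "- Q i i \<le> h"
begin

text \<open>The uniformized chain: a stochastic matrix with the same invariant measures.\<close>

definition unif :: "'a \<Rightarrow> 'a \<Rightarrow> real" where
  "unif i j = (if i = j then 1 else 0) + Q i j / h"

lemma unif_nonneg: "0 \<le> unif i j"
  using intensity h_pos diag_le[of i]
  by (auto simp: unif_def intensity_matrix_def field_simps)

lemma Q_eq_unif: "Q i j = h * unif i j - (if i = j then h else 0)"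
  using h_pos by (simp add: unif_def field_simps)

lemma integrable_row: "integrable counting (Q i)"
  and integral_row: "(\<integral>j. Q i j \<partial>counting) = 0"
  using cons by (simp_all add: conservative_def has_sum_iff_counting)

lemma unif_row_sum: "(\<integral>\<^sup>+j. ennreal (unif i j) \<partial>counting) = 1"
proof -
  have unif_eq: "unif i = (\<lambda>j. (if j = i then 1 else 0) + Q i j / h)"
    by (auto simp: unif_def)
  have "integrable counting (\<lambda>j. Q i j / h)" "(\<integral>j. Q i j / h \<partial>counting) = 0"
    using integrable_row integral_row by simp_all
  note Qh = this and single = integral_counting_single[of i "\<lambda>_. 1"]
  have "integrable counting (unif i)" "(\<integral>j. unif i j \<partial>counting) = 1"
    unfolding unif_eq
    using Bochner_Integration.integrable_add[OF single(1) Qh(1)]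
      Bochner_Integration.integral_add[OF single(1) Qh(1)]
    by (auto simp only: single(2) Qh(2) add_0_right)
  then show ?thesis
    using unif_nonneg by (simp add: nn_integral_eq_integral)
qed

text \<open>\<open>\<bar>Q i j\<bar>\<close> is at most \<open>h * unif i j\<close> plus
  \<open>h\<close> on the diagonal; the rows of \<open>unif\<close> sum to 1, so each of the two
  parts contributes \<open>h\<close>.\<close>

lemma abs_row_sum_le: "(\<integral>\<^sup>+j. ennreal \<bar>Q i j\<bar> \<partial>counting) \<le> ennreal (2 * h)"
proof -
  have "(\<integral>\<^sup>+j. ennreal \<bar>Q i j\<bar> \<partial>counting)
      \<le> (\<integral>\<^sup>+j. ennreal h * ennreal (unif i j) + (if i = j then ennreal h else 0) \<partial>counting)"
  proof (intro nn_integral_mono)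
    fix j
    have "\<bar>Q i j\<bar> \<le> h * unif i j + (if i = j then h else 0)"
    proof -
      have "0 \<le> h * unif i j" using h_pos unif_nonneg[of i j] by simp
      then show ?thesis using h_pos Q_eq_unif[of i j] by (simp split: if_splits)
    qed
    then have "ennreal \<bar>Q i j\<bar> \<le> ennreal (h * unif i j + (if i = j then h else 0))"
      by (rule ennreal_leI)
    also have "\<dots> = ennreal h * ennreal (unif i j) + (if i = j then ennreal h else 0)"
      using h_pos unif_nonneg[of i j] by (cases "i = j") (simp_all add: ennreal_mult)
    finally show "ennreal \<bar>Q i j\<bar> \<le> ennreal h * ennreal (unif i j) + (if i = j then ennreal h else 0)" .
  qed
  also have "\<dots> = ennreal h + ennreal h"
    by (simp add: nn_integral_add nn_integral_cmult unif_row_sum nn_integral_counting_single)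
  also have "\<dots> = ennreal (2 * h)"
    using h_pos ennreal_plus[of h h] by simp
  finally show ?thesis .
qed

lemma abs_entry_le: "\<bar>Q i j\<bar> \<le> 2 * h"
proof -
  have "ennreal \<bar>Q i j\<bar> \<le> ennreal (2 * h)"
    using term_le_nn_integral_counting[of "\<lambda>j. ennreal \<bar>Q i j\<bar>" j] abs_row_sum_le by (rule order_trans)
  then show ?thesis using h_pos by (simp add: ennreal_le_iff)
qed

lemma integrable_pmf_column: "integrable counting (\<lambda>i. pmf \<mu> i * Q i j)"
  by (rule integrable_pmf_mult_bounded) (rule abs_entry_le)

text \<open>Column by column, \<mu> \<open>unif\<close> is \<mu> plus \<mu> Q divided by
  \<open>h\<close>.\<close>

lemma invariant_unif_iff:
  "(\<integral>\<^sup>+i. ennreal (pmf \<mu> i * unif i j) \<partial>counting) = ennreal (pmf \<mu> j)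
    \<longleftrightarrow> (\<integral>i. pmf \<mu> i * Q i j \<partial>counting) = 0"
proof -
  have unif_eq: "(\<lambda>i. pmf \<mu> i * unif i j) = (\<lambda>i. (if i = j then pmf \<mu> i else 0) + pmf \<mu> i * Q i j / h)"
    by (auto simp: unif_def distrib_left)
  have Qh: "integrable counting (\<lambda>i. pmf \<mu> i * Q i j / h)"
    "(\<integral>i. pmf \<mu> i * Q i j / h \<partial>counting) = (\<integral>i. pmf \<mu> i * Q i j \<partial>counting) / h"
    using integrable_pmf_column[of \<mu> j] by simp_all
  note single = integral_counting_single[of j "pmf \<mu>"]
  have int: "integrable counting (\<lambda>i. pmf \<mu> i * unif i j)"
    and eq: "(\<integral>i. pmf \<mu> i * unif i j \<partial>counting) = pmf \<mu> j + (\<integral>i. pmf \<mu> i * Q i j \<partial>counting) / h"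
    unfolding unif_eq
    using Bochner_Integration.integrable_add[OF single(1) Qh(1)]
      Bochner_Integration.integral_add[OF single(1) Qh(1)]
    by (auto simp only: single(2) Qh(2))
  have nonneg: "0 \<le> pmf \<mu> i * unif i j" for i
    using unif_nonneg by simp
  have "(\<integral>\<^sup>+i. ennreal (pmf \<mu> i * unif i j) \<partial>counting)
      = ennreal (pmf \<mu> j + (\<integral>i. pmf \<mu> i * Q i j \<partial>counting) / h)"
    using nn_integral_eq_integral[OF int] nonneg eq by simp
  moreover have "0 \<le> pmf \<mu> j + (\<integral>i. pmf \<mu> i * Q i j \<partial>counting) / h"
    using Bochner_Integration.integral_nonneg[of counting "\<lambda>i. pmf \<mu> i * unif i j"] nonneg eq by simp
  ultimately show ?thesis using h_pos by (simp add: ennreal_inj)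
qed

lemma balanced_iff_invariant_unif:
  "balanced Q \<mu> \<longleftrightarrow> (\<forall>j. (\<integral>\<^sup>+i. ennreal (pmf \<mu> i * unif i j) \<partial>counting) = ennreal (pmf \<mu> j))"
  by (simp add: balanced_def invariant_unif_iff)

lemma invariant_unif:
  "balanced Q \<mu> \<Longrightarrow> (\<integral>\<^sup>+i. ennreal (pmf \<mu> i) * ennreal (unif i j) \<partial>counting) = ennreal (pmf \<mu> j)"
  using balanced_iff_invariant_unif[of \<mu>] unif_nonneg by (simp add: ennreal_mult)

text \<open>A first-order expansion of \<open>\<mu> exp (Q t) = \<mu>\<close> at \<open>t = 0\<close> gives \<open>\<mu> Q = 0\<close>.\<close>

lemma invariant_prob_imp_balanced:
  assumes inv: "invariant_prob Q \<mu>"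
  shows "balanced Q \<mu>"
  unfolding balanced_def
proof
  fix j
  define I where "I = (\<integral>i. pmf \<mu> i * Q i j \<partial>counting)"
  define B where "B = (2 * h)\<^sup>2 * exp (2 * h)"
  have B: "0 \<le> B" by (simp add: B_def)
  \<comment> \<open>Integrating the remainder \<open>R\<close> against \<mu> leaves
    \<open>- t * I\<close>, because exp (Q t) fixes \<mu>, while \<open>R\<close> is of order t^2;
    dividing by \<open>t\<close> gives the estimate.\<close>
  have small: "\<bar>I\<bar> \<le> t * B" if t: "0 < t" "t \<le> 1" for t
  proof -
    define R where "R i = transition_function Q t i j - (if i = j then 1 else 0) - t * Q i j" for i
    have R: "\<bar>R i\<bar> \<le> t\<^sup>2 * B" for i
      unfolding R_def B_def using t h_pos abs_row_sum_le
      by (intro transition_function_near_identity) auto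
    have intR: "integrable counting (\<lambda>i. pmf \<mu> i * R i)"
      by (rule integrable_pmf_mult_bounded) (rule R)
    have Rle: "\<bar>pmf \<mu> i * R i\<bar> \<le> t\<^sup>2 * B * pmf \<mu> i" for i
      using mult_right_mono[OF R[of i], of "pmf \<mu> i"] by (simp add: abs_mult mult.commute)
    have K: "integrable counting (\<lambda>i. pmf \<mu> i * transition_function Q t i j)"
      "(\<integral>i. pmf \<mu> i * transition_function Q t i j \<partial>counting) = pmf \<mu> j"
      using inv t by (auto simp: invariant_prob_def has_sum_iff_counting)
    have "(\<lambda>i. pmf \<mu> i * R i)
        = (\<lambda>i. pmf \<mu> i * transition_function Q t i j - (if i = j then pmf \<mu> i else 0) - t * (pmf \<mu> i * Q i j))"
      by (auto simp: R_def field_simps)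
    then have "(\<integral>i. pmf \<mu> i * R i \<partial>counting) = - t * I"
      using K integral_counting_single[of j "pmf \<mu>"] integrable_pmf_column[of \<mu> j]
      by (simp add: I_def)
    moreover have "\<bar>\<integral>i. pmf \<mu> i * R i \<partial>counting\<bar> \<le> (\<integral>i. (t\<^sup>2 * B) * pmf \<mu> i \<partial>counting)"
      by (rule order_trans[OF integral_abs_bound integral_mono])
         (use intR Rle in \<open>auto simp: integrable_pmf\<close>)
    moreover have "(\<integral>i. pmf \<mu> i \<partial>counting) = 1"
      by (simp add: integral_pmf)
    ultimately have "t * \<bar>I\<bar> \<le> t * (t * B)"
      using t by (simp add: abs_mult power2_eq_square)
    then show ?thesis using t by simp
  qed
  show "(\<integral>i. pmf \<mu> i * Q i j \<partial>counting) = 0"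
  proof (rule ccontr)
    assume "(\<integral>i. pmf \<mu> i * Q i j \<partial>counting) \<noteq> 0"
    then have I: "0 < \<bar>I\<bar>" by (simp add: I_def)
    \<comment> \<open>With this \<open>t\<close> the estimate \<open>small\<close> bounds
      \<bar>I\<bar> by half of itself.\<close>
    define t where "t = min 1 (\<bar>I\<bar> / (2 * (B + 1)))"
    have "0 < t" "t \<le> 1" using I B by (auto simp: t_def)
    then have "\<bar>I\<bar> \<le> t * B" by (rule small)
    also have "\<dots> \<le> \<bar>I\<bar> / (2 * (B + 1)) * B"
      using B by (intro mult_right_mono) (auto simp: t_def)
    also have "\<dots> \<le> \<bar>I\<bar> / 2" using B I by (simp add: field_simps)
    finally show False using I by simp
  qed
qed

text \<open>By associativity \<mu> A^(n+1) = (\<mu> A^n) A, which vanishes from the first power on.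
  The interchange of sums is justified by the bounded row sums of A^n together with the bounded
  entries of A.\<close>

lemma balanced_matrix_power:
  assumes bal: "balanced Q \<mu>" and t: "0 \<le> t"
  shows "(\<integral>i. pmf \<mu> i * matrix_power (\<lambda>k l. Q k l * t) n i j \<partial>counting) = (if n = 0 then pmf \<mu> j else 0)"
proof (induction n arbitrary: j)
  case 0
  have "(\<integral>i. pmf \<mu> i * matrix_power (\<lambda>k l. Q k l * t) 0 i j \<partial>counting)
      = (\<integral>i. (if i = j then pmf \<mu> i else 0) \<partial>counting)"
    by (rule Bochner_Integration.integral_cong) auto
  then show ?case by (simp add: integral_counting_single)
next
  case (Suc n)
  define A where "A = (\<lambda>k l. Q k l * t)"
  have A: "(\<integral>\<^sup>+j. ennreal \<bar>A i j\<bar> \<partial>counting) \<le> ennreal (2 * h * t)" for i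
    unfolding A_def using h_pos t by (intro scaled_row_sum_le abs_row_sum_le) auto
  have C: "0 \<le> 2 * h * t" using h_pos t by simp
  have Aj: "\<bar>A k j\<bar> \<le> 2 * h * t" for k
    unfolding A_def abs_mult using t by (intro mult_mono abs_entry_le) (use h_pos in auto)
  have "(\<integral>\<^sup>+i. \<integral>\<^sup>+k. ennreal \<bar>pmf \<mu> i * (matrix_power A n i k * A k j)\<bar> \<partial>counting \<partial>counting)
      \<le> (\<integral>\<^sup>+i. \<integral>\<^sup>+k. ennreal (pmf \<mu> i) * ennreal \<bar>matrix_power A n i k\<bar> * ennreal (2 * h * t) \<partial>counting \<partial>counting)"
    using Aj C
    by (intro nn_integral_mono)
       (auto simp: abs_mult ennreal_mult[symmetric] mult.assoc intro!: ennreal_leI mult_left_mono)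
  also have "\<dots> = (\<integral>\<^sup>+i. ennreal (pmf \<mu> i) * (\<integral>\<^sup>+k. ennreal \<bar>matrix_power A n i k\<bar> \<partial>counting) * ennreal (2 * h * t) \<partial>counting)"
    by (simp add: nn_integral_cmult nn_integral_multc)
  also have "\<dots> \<le> (\<integral>\<^sup>+i. ennreal (pmf \<mu> i) * ennreal ((2 * h * t) ^ n) * ennreal (2 * h * t) \<partial>counting)"
    by (intro nn_integral_mono mult_right_mono mult_left_mono matrix_power_row_sum_le[OF A C]) auto
  also have "\<dots> = ennreal ((2 * h * t) ^ n) * ennreal (2 * h * t)"
    by (simp add: nn_integral_multc nn_integral_pmf_eq_1 nn_integral_pmf)
  also have "\<dots> < \<infinity>" by (simp add: ennreal_mult_less_top)
  finally have fin: "(\<integral>\<^sup>+i. \<integral>\<^sup>+k. ennreal \<bar>pmf \<mu> i * (matrix_power A n i k * A k j)\<bar> \<partial>counting \<partial>counting) < \<infinity>" .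
  have "(\<integral>i. pmf \<mu> i * matrix_power A (Suc n) i j \<partial>counting)
      = (\<integral>i. \<integral>k. pmf \<mu> i * (matrix_power A n i k * A k j) \<partial>counting \<partial>counting)"
    by (simp only: matrix_power_Suc_integral integral_mult_right_zero)
  also have "\<dots> = (\<integral>k. \<integral>i. pmf \<mu> i * (matrix_power A n i k * A k j) \<partial>counting \<partial>counting)"
    by (rule integral_counting_swap[OF fin])
  also have "\<dots> = (\<integral>k. (\<integral>i. pmf \<mu> i * matrix_power A n i k \<partial>counting) * A k j \<partial>counting)"
    by (simp only: mult.assoc[symmetric] integral_mult_left_zero)
  also have "\<dots> = (\<integral>k. (if n = 0 then pmf \<mu> k else 0) * A k j \<partial>counting)"
    using Suc by (simp add: A_def)
  also have "\<dots> = 0"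
    using bal by (cases "n = 0") (auto simp: A_def balanced_def mult.assoc[symmetric])
  finally show ?case by (simp add: A_def)
qed

text \<open>The series for exp (Q t) is integrated term by term against \<mu>, dominated by the
  terms C^n / n!; only the term n = 0 survives, and it gives back \<mu>.\<close>

lemma balanced_imp_invariant_prob:
  assumes bal: "balanced Q \<mu>"
  shows "invariant_prob Q \<mu>"
  unfolding invariant_prob_def
proof (intro allI impI)
  fix t :: real and j assume t: "0 \<le> t"
  define A where "A = (\<lambda>k l. Q k l * t)"
  define C where "C = 2 * h * t"
  have A: "(\<integral>\<^sup>+j. ennreal \<bar>A i j\<bar> \<partial>counting) \<le> ennreal C" for i
    unfolding A_def C_def using h_pos t by (intro scaled_row_sum_le abs_row_sum_le) auto
  have C: "0 \<le> C" using h_pos t by (simp add: C_def)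
  define f where "f n i = pmf \<mu> i * (matrix_power A n i j / fact n)" for n i
  have fb: "\<bar>matrix_power A n i j / fact n\<bar> \<le> C ^ n / fact n" for n i
    using abs_matrix_power_le[where A = A and C = C, OF A C] by (simp add: divide_right_mono)
  have intf: "integrable counting (f n)" for n
    unfolding f_def by (rule integrable_pmf_mult_bounded) (rule fb)
  have sumf: "summable (\<lambda>n. norm (f n i))" for i
    unfolding f_def real_norm_def abs_mult[of "pmf \<mu> i"]
    by (intro summable_mult transition_function_summable[where C = C] A C)
  have sumC: "summable (\<lambda>n. C ^ n / fact n)"
    using summable_exp_generic[of C] by (simp add: field_simps)
  have normf: "(\<integral>i. norm (f n i) \<partial>counting) \<le> C ^ n / fact n" for n
  proof -
    have "(\<integral>i. norm (f n i) \<partial>counting) \<le> (\<integral>i. (C ^ n / fact n) * pmf \<mu> i \<partial>counting)"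
    proof (rule integral_mono)
      show "norm (f n i) \<le> C ^ n / fact n * pmf \<mu> i" for i
        unfolding f_def real_norm_def abs_mult[of "pmf \<mu> i"]
        using mult_right_mono[OF fb[of n i], of "pmf \<mu> i"] by (simp add: mult.commute)
    qed (use intf in \<open>auto simp: integrable_pmf\<close>)
    then show ?thesis by (simp add: integral_pmf)
  qed
  have sumI: "summable (\<lambda>n. \<integral>i. norm (f n i) \<partial>counting)"
  proof (rule summable_comparison_test'[OF sumC, of 0])
    show "norm (\<integral>i. norm (f n i) \<partial>counting) \<le> C ^ n / fact n" for n
      using normf[of n] Bochner_Integration.integral_nonneg[of counting "\<lambda>i. norm (f n i)"] by simp
  qed
  have suminf_f: "(\<Sum>n. f n i) = pmf \<mu> i * transition_function Q t i j" for i
    unfolding f_def transition_function_def A_def[symmetric]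
    by (rule suminf_mult, rule summable_rabs_cancel, rule transition_function_summable[OF _ C]) (rule A)
  have If: "(\<integral>i. f n i \<partial>counting) = (if n = 0 then pmf \<mu> j else 0)" for n
    using balanced_matrix_power[OF bal t, of n j]
    by (auto simp: f_def A_def simp del: matrix_power.simps)
  have AE_sumf: "AE i in counting. summable (\<lambda>n. norm (f n i))"
    using sumf by simp
  have "integrable counting (\<lambda>i. \<Sum>n. f n i)"
    by (rule integrable_suminf[OF intf AE_sumf sumI])
  moreover have "(\<integral>i. (\<Sum>n. f n i) \<partial>counting) = (\<Sum>n. (\<integral>i. f n i \<partial>counting))"
    by (rule integral_suminf[OF intf AE_sumf sumI])
  moreover have "(\<Sum>n. (\<integral>i. f n i \<partial>counting)) = pmf \<mu> j"
    unfolding If using sums_single[of 0 "\<lambda>_. pmf \<mu> j"] by (simp add: sums_iff)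
  ultimately show "((\<lambda>i. pmf \<mu> i * transition_function Q t i j) has_sum pmf \<mu> j) UNIV"
    unfolding has_sum_iff_counting suminf_f by simp
qed

lemma invariant_prob_iff_balanced: "invariant_prob Q \<mu> \<longleftrightarrow> balanced Q \<mu>"
  using invariant_prob_imp_balanced balanced_imp_invariant_prob by blast

text \<open>Positive mass is passed along edges: by invariance under \<open>unif\<close>, the mass
  at \<open>l\<close> is at least the mass at \<open>k\<close> times \<open>unif k l\<close>.
  Irreducibility connects a point of the support to every state.\<close>

lemma pmf_pos:
  assumes irr: "irreducible_matrix Q" and bal: "balanced Q \<mu>"
  shows "0 < pmf \<mu> j"
proof -
  obtain i where i: "i \<in> set_pmf \<mu>" using set_pmf_not_empty[of \<mu>] by blast
  have "(i, j) \<in> {(k, l). k \<noteq> l \<and> Q k l > 0}\<^sup>*" using irr by (simp add: irreducible_matrix_def)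
  then show ?thesis
  proof induction
    case base
    show ?case using i by (simp add: pmf_positive)
  next
    case (step k l)
    have "k \<noteq> l" "0 < Q k l" using step.hyps(2) by auto
    then have "0 < unif k l" using h_pos by (simp add: unif_def)
    then have "0 < ennreal (pmf \<mu> k) * ennreal (unif k l)"
      using step.IH by (simp add: ennreal_zero_less_mult_iff)
    also have "\<dots> \<le> (\<integral>\<^sup>+i. ennreal (pmf \<mu> i) * ennreal (unif i l) \<partial>counting)"
      by (rule term_le_nn_integral_counting)
    also have "\<dots> = ennreal (pmf \<mu> l)"
      by (rule invariant_unif[OF bal])
    finally show ?case by simp
  qed
qed

end

section \<open>The drift condition\<close>

text \<open>Tonelli; it moves a kernel from the measure to the test function, where row sums and
  drift are known.\<close>

lemma kernel_assoc:
  fixes m :: "'a::countable \<Rightarrow> ennreal"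
  shows "(\<integral>\<^sup>+j. (\<integral>\<^sup>+i. m i * P i j \<partial>counting) * W j \<partial>counting)
    = (\<integral>\<^sup>+i. m i * (\<integral>\<^sup>+j. P i j * W j \<partial>counting) \<partial>counting)"
  by (simp add: nn_integral_multc[symmetric] nn_integral_cmult[symmetric] mult.assoc)
     (rule nn_integral_counting_swap[symmetric])

lemma nn_integral_counting_split:
  fixes f :: "'a \<Rightarrow> ennreal"
  shows "(\<integral>\<^sup>+j. f j \<partial>counting) = f i + (\<integral>\<^sup>+j. (if j = i then 0 else f j) \<partial>counting)"
proof -
  have "(\<integral>\<^sup>+j. f j \<partial>counting)
      = (\<integral>\<^sup>+j. (if j = i then f j else 0) + (if j = i then 0 else f j) \<partial>counting)"
    by (intro nn_integral_cong) auto
  also have "\<dots> = f i + (\<integral>\<^sup>+j. (if j = i then 0 else f j) \<partial>counting)"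
    by (simp only: nn_integral_add borel_measurable_count_space nn_integral_counting_single)
  finally show ?thesis .
qed

text \<open>The inequality \<open>lam \<le> h\<close> makes the contraction factor
  \<open>1 - lam / h\<close> nonnegative, as arithmetic in \<open>ennreal\<close> demands.
  Positivity of \<open>V\<close> is pointwise here; the uniform lower bound enters separately, in
  \<open>ex_balanced\<close>.\<close>

locale drift_generator = bounded_generator +
  fixes V :: "'a \<Rightarrow> real" and lam b :: real and i0 :: 'a
  assumes irr: "irreducible_matrix Q" and V_pos: "0 < V i"
    and lam_pos: "0 < lam" and b_nonneg: "0 \<le> b" and lam_le: "lam \<le> h"
    and drift: "drift_condition Q V lam b i0"
begin

text \<open>Dividing the drift condition by \<open>h\<close> and adding \<open>V\<close> turns it
  into a contraction of \<open>V\<close> by \<open>unif\<close>, up to a term at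
  \<open>i0\<close>.\<close>

lemma drift_unif:
  "(\<integral>\<^sup>+j. ennreal (unif i j) * ennreal (V j) \<partial>counting)
    \<le> ennreal (1 - lam / h) * ennreal (V i) + (if i = i0 then ennreal (b / h) else 0)"
proof -
  have QV: "integrable counting (\<lambda>j. Q i j * V j)"
    and le: "(\<integral>j. Q i j * V j \<partial>counting) \<le> - lam * V i + b * indicator {i0} i"
    using drift by (simp_all add: drift_condition_def summable_on_iff_integrable_counting infsum_eq_integral_counting)
  have unif_eq: "(\<lambda>j. unif i j * V j) = (\<lambda>j. (if j = i then V j else 0) + Q i j * V j / h)"
    by (auto simp: unif_def distrib_right)
  have Qh: "integrable counting (\<lambda>j. Q i j * V j / h)"
    "(\<integral>j. Q i j * V j / h \<partial>counting) = (\<integral>j. Q i j * V j \<partial>counting) / h"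
    using QV by simp_all
  note single = integral_counting_single[of i V]
  have int: "integrable counting (\<lambda>j. unif i j * V j)"
    and eq: "(\<integral>j. unif i j * V j \<partial>counting) = V i + (\<integral>j. Q i j * V j \<partial>counting) / h"
    unfolding unif_eq
    using Bochner_Integration.integrable_add[OF single(1) Qh(1)]
      Bochner_Integration.integral_add[OF single(1) Qh(1)]
    by (auto simp only: single(2) Qh(2))
  have nonneg: "0 \<le> unif i j * V j" for j
    using unif_nonneg[of i j] V_pos[of j] by simp
  have eps: "0 \<le> 1 - lam / h" using lam_le h_pos by simp
  have "(\<integral>\<^sup>+j. ennreal (unif i j) * ennreal (V j) \<partial>counting) = (\<integral>\<^sup>+j. ennreal (unif i j * V j) \<partial>counting)"
    using unif_nonneg by (intro nn_integral_cong) (simp add: ennreal_mult')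
  also have "\<dots> = ennreal (V i + (\<integral>j. Q i j * V j \<partial>counting) / h)"
    using nn_integral_eq_integral[OF int] nonneg eq by simp
  also have "\<dots> \<le> ennreal ((1 - lam / h) * V i + (if i = i0 then b / h else 0))"
  proof (rule ennreal_leI)
    have "(\<integral>j. Q i j * V j \<partial>counting) / h \<le> (- lam * V i + b * indicator {i0} i) / h"
      using le h_pos by (intro divide_right_mono) auto
    then show "V i + (\<integral>j. Q i j * V j \<partial>counting) / h \<le> (1 - lam / h) * V i + (if i = i0 then b / h else 0)"
      by (auto simp: diff_divide_distrib add_divide_distrib left_diff_distrib split: if_splits)
  qed
  also have "\<dots> = ennreal (1 - lam / h) * ennreal (V i) + (if i = i0 then ennreal (b / h) else 0)"
    using eps b_nonneg h_pos V_pos[of i] less_imp_le[OF V_pos[of i]]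
    by (cases "i = i0") (simp_all add: ennreal_mult' ennreal_plus)
  finally show ?thesis .
qed

text \<open>The same inequality with the decay on the left: a subtraction-free form, from which
  finite common terms can later be cancelled.\<close>

lemma drift_unif':
  "(\<integral>\<^sup>+j. ennreal (unif i j) * ennreal (V j) \<partial>counting) + ennreal (lam / h) * ennreal (V i)
    \<le> ennreal (V i) + (if i = i0 then ennreal (b / h) else 0)"
proof -
  have "ennreal (1 - lam / h) * ennreal (V i) + ennreal (lam / h) * ennreal (V i) = ennreal (V i)"
    using lam_le h_pos lam_pos by (simp add: distrib_right[symmetric] ennreal_plus[symmetric] del: ennreal_plus)
  then have "ennreal (1 - lam / h) * ennreal (V i) + (if i = i0 then ennreal (b / h) else 0)
      + ennreal (lam / h) * ennreal (V i) = ennreal (V i) + (if i = i0 then ennreal (b / h) else 0)"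
    by (metis add.assoc add.commute)
  then show ?thesis
    using add_right_mono[OF drift_unif[of i], of "ennreal (lam / h) * ennreal (V i)"]
    by (rule ord_le_eq_trans[rotated])
qed

text \<open>Testing invariance on the truncations \<open>min (V i) n\<close>, because \<open>V\<close> is not yet known to be
  \<open>\<mu>\<close>-integrable.\<close>

lemma integral_V_le:
  assumes bal: "balanced Q \<mu>"
  shows "(\<integral>\<^sup>+i. ennreal (pmf \<mu> i) * ennreal (V i) \<partial>counting) \<le> ennreal (b / lam)"
proof -
  define e where "e = ennreal (lam / h)"
  define \<beta> where "\<beta> = ennreal (b / h)"
  have step: "e * (\<integral>\<^sup>+i. ennreal (pmf \<mu> i) * (if V i \<le> real n then ennreal (V i) else 0) \<partial>counting) \<le> \<beta>" for n :: nat
  proof -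
    define W where "W i = ennreal (min (V i) (real n))" for i
    have W_le: "W i \<le> ennreal (real n)" for i
      unfolding W_def by (intro ennreal_leI) simp
    \<comment> \<open>Where \<open>V i \<le> real n\<close> the drift inequality applies, since
      \<open>W\<close> lies below \<open>V\<close>. Elsewhere \<open>W i\<close> has its maximal
      value \<open>real n\<close>, which no average over a row of \<open>unif\<close> exceeds, and
      the decay term is switched off.\<close>
    have pointwise: "(\<integral>\<^sup>+j. ennreal (unif i j) * W j \<partial>counting) + e * (if V i \<le> real n then ennreal (V i) else 0)
        \<le> W i + \<beta>" for i
    proof (cases "V i \<le> real n")
      case True
      have "(\<integral>\<^sup>+j. ennreal (unif i j) * W j \<partial>counting) + e * ennreal (V i)
          \<le> (\<integral>\<^sup>+j. ennreal (unif i j) * ennreal (V j) \<partial>counting) + e * ennreal (V i)"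
        unfolding W_def by (intro add_right_mono nn_integral_mono mult_left_mono ennreal_leI) auto
      also have "\<dots> \<le> ennreal (V i) + (if i = i0 then ennreal (b / h) else 0)"
        unfolding e_def by (rule drift_unif')
      also have "\<dots> \<le> ennreal (V i) + \<beta>"
        by (intro add_left_mono) (simp add: \<beta>_def)
      finally show ?thesis using True by (simp add: W_def)
    next
      case False
      have "(\<integral>\<^sup>+j. ennreal (unif i j) * W j \<partial>counting)
          \<le> (\<integral>\<^sup>+j. ennreal (unif i j) * ennreal (real n) \<partial>counting)"
        by (intro nn_integral_mono mult_left_mono W_le) simp
      also have "\<dots> = W i"
        using False by (simp add: nn_integral_multc unif_row_sum W_def)
      finally show ?thesis using False by (simp add: add_increasing2)
    qed
    define I where "I = (\<integral>\<^sup>+i. ennreal (pmf \<mu> i) * W i \<partial>counting)"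
    \<comment> \<open>Truncation makes \<open>I\<close> finite; this permits cancelling it in the
      last step.\<close>
    have "I \<le> (\<integral>\<^sup>+i. ennreal (pmf \<mu> i) * ennreal (real n) \<partial>counting)"
      unfolding I_def by (intro nn_integral_mono mult_left_mono W_le) simp
    also have "\<dots> = ennreal (real n)"
      by (simp add: nn_integral_multc nn_integral_pmf_eq_1)
    finally have I_fin: "I \<noteq> \<top>"
      by (auto simp: top_unique)
    have "I = (\<integral>\<^sup>+j. (\<integral>\<^sup>+i. ennreal (pmf \<mu> i) * ennreal (unif i j) \<partial>counting) * W j \<partial>counting)"
      by (simp add: I_def invariant_unif[OF bal])
    also have "\<dots> = (\<integral>\<^sup>+i. ennreal (pmf \<mu> i) * (\<integral>\<^sup>+j. ennreal (unif i j) * W j \<partial>counting) \<partial>counting)"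
      by (rule kernel_assoc)
    finally have "I + e * (\<integral>\<^sup>+i. ennreal (pmf \<mu> i) * (if V i \<le> real n then ennreal (V i) else 0) \<partial>counting)
        = (\<integral>\<^sup>+i. ennreal (pmf \<mu> i) * ((\<integral>\<^sup>+j. ennreal (unif i j) * W j \<partial>counting)
            + e * (if V i \<le> real n then ennreal (V i) else 0)) \<partial>counting)"
      by (simp add: distrib_left nn_integral_add nn_integral_cmult[symmetric] mult.left_commute)
    also have "\<dots> \<le> (\<integral>\<^sup>+i. ennreal (pmf \<mu> i) * (W i + \<beta>) \<partial>counting)"
      by (intro nn_integral_mono mult_left_mono pointwise) simp
    also have "\<dots> = I + \<beta>"
      by (simp add: distrib_left nn_integral_add nn_integral_multc nn_integral_pmf_eq_1 I_def)
    finally show ?thesis using I_fin by (simp add: ennreal_add_left_cancel_le)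
  qed
  have "(\<integral>\<^sup>+i. ennreal (pmf \<mu> i) * ennreal (V i) \<partial>counting)
      = (\<integral>\<^sup>+i. (SUP n. ennreal (pmf \<mu> i) * (if V i \<le> real n then ennreal (V i) else 0)) \<partial>counting)"
  proof (intro nn_integral_cong antisym)
    fix i
    obtain n where "V i \<le> real n" using real_arch_simple by blast
    then have "ennreal (pmf \<mu> i) * ennreal (V i) = ennreal (pmf \<mu> i) * (if V i \<le> real n then ennreal (V i) else 0)"
      by simp
    also have "\<dots> \<le> (SUP n. ennreal (pmf \<mu> i) * (if V i \<le> real n then ennreal (V i) else 0))"
      by (rule SUP_upper) simp
    finally show "ennreal (pmf \<mu> i) * ennreal (V i)
        \<le> (SUP n. ennreal (pmf \<mu> i) * (if V i \<le> real n then ennreal (V i) else 0))" .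
  qed (auto intro!: SUP_least)
  also have "\<dots> = (SUP n. \<integral>\<^sup>+i. ennreal (pmf \<mu> i) * (if V i \<le> real n then ennreal (V i) else 0) \<partial>counting)"
  proof (rule nn_integral_monotone_convergence_SUP)
    show "incseq (\<lambda>n i. ennreal (pmf \<mu> i) * (if V i \<le> real n then ennreal (V i) else 0))"
      unfolding incseq_def le_fun_def by (auto intro!: mult_left_mono)
  qed simp
  finally have "e * (\<integral>\<^sup>+i. ennreal (pmf \<mu> i) * ennreal (V i) \<partial>counting) \<le> \<beta>"
    by (simp only: SUP_mult_left_ennreal) (auto intro!: SUP_least step)
  then have "ennreal (h / lam) * (e * (\<integral>\<^sup>+i. ennreal (pmf \<mu> i) * ennreal (V i) \<partial>counting)) \<le> ennreal (h / lam) * \<beta>"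
    by (rule mult_left_mono) simp
  moreover have "ennreal (h / lam) * e = 1" "ennreal (h / lam) * \<beta> = ennreal (b / lam)"
    unfolding e_def \<beta>_def using h_pos lam_pos b_nonneg by (simp_all add: ennreal_mult[symmetric])
  ultimately show ?thesis by (simp add: mult.assoc[symmetric])
qed

text \<open>The invariant measure is built as the expected occupation measure of an excursion from
  \<open>i0\<close> of the uniformized chain.  The drift condition bounds its \<open>V\<close>-norm.\<close>

primrec occupation :: "nat \<Rightarrow> 'a \<Rightarrow> ennreal" where
  "occupation 0 = (\<lambda>j. 0)"
| "occupation (Suc n) = (\<lambda>j. if j = i0 then 1 else \<integral>\<^sup>+i. occupation n i * ennreal (unif i j) \<partial>counting)"

text \<open>The recursion is monotone in the previous iterate and starts from 0.
  \<open>occupation n\<close> counts the expected visits at times below \<open>n\<close> and before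
  the first return to \<open>i0\<close>.\<close>

lemma occupation_mono: "occupation n j \<le> occupation (Suc n) j"
proof (induction n arbitrary: j)
  case (Suc n)
  then show ?case
    unfolding occupation.simps(2)[of "Suc n"] occupation.simps(2)[of n]
    by (auto intro!: nn_integral_mono mult_right_mono simp del: occupation.simps)
qed simp

text \<open>The bound is the fixed point of M = V i0 + (1 - lam / h) M + b / h, so it survives the
  recursion. The term b / h is charged at most once because \<open>occupation n i0\<close> is at
  most 1.\<close>

lemma occupation_V_le:
  "(\<integral>\<^sup>+j. occupation n j * ennreal (V j) \<partial>counting) \<le> ennreal ((V i0 + b / h) * h / lam)"
proof (induction n)
  case (Suc n)
  define M where "M = (V i0 + b / h) * h / lam"
  have M: "0 \<le> M" using V_pos[of i0] b_nonneg h_pos lam_pos by (simp add: M_def)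
  have occ1: "occupation n i0 \<le> 1" by (cases n) auto
  have "(\<integral>\<^sup>+j. occupation (Suc n) j * ennreal (V j) \<partial>counting)
      \<le> (\<integral>\<^sup>+j. (if j = i0 then ennreal (V j) else 0)
          + (\<integral>\<^sup>+i. occupation n i * ennreal (unif i j) \<partial>counting) * ennreal (V j) \<partial>counting)"
    by (intro nn_integral_mono) auto
  also have "\<dots> = ennreal (V i0) + (\<integral>\<^sup>+j. (\<integral>\<^sup>+i. occupation n i * ennreal (unif i j) \<partial>counting) * ennreal (V j) \<partial>counting)"
    by (simp add: nn_integral_add nn_integral_counting_single)
  also have "\<dots> = ennreal (V i0) + (\<integral>\<^sup>+i. occupation n i * (\<integral>\<^sup>+j. ennreal (unif i j) * ennreal (V j) \<partial>counting) \<partial>counting)"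
    by (simp only: kernel_assoc)
  also have "\<dots> \<le> ennreal (V i0) + (\<integral>\<^sup>+i. occupation n i *
      (ennreal (1 - lam / h) * ennreal (V i) + (if i = i0 then ennreal (b / h) else 0)) \<partial>counting)"
    by (intro add_left_mono nn_integral_mono mult_left_mono drift_unif) simp
  also have "(\<integral>\<^sup>+i. occupation n i *
      (ennreal (1 - lam / h) * ennreal (V i) + (if i = i0 then ennreal (b / h) else 0)) \<partial>counting)
      = (\<integral>\<^sup>+i. ennreal (1 - lam / h) * (occupation n i * ennreal (V i))
          + (if i = i0 then occupation n i * ennreal (b / h) else 0) \<partial>counting)"
    by (intro nn_integral_cong) (simp add: distrib_left mult.left_commute)
  also have "\<dots> = ennreal (1 - lam / h) * (\<integral>\<^sup>+i. occupation n i * ennreal (V i) \<partial>counting)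
      + occupation n i0 * ennreal (b / h)"
    by (simp add: nn_integral_add nn_integral_cmult nn_integral_counting_single)
  also have "\<dots> \<le> ennreal (1 - lam / h) * ennreal M + 1 * ennreal (b / h)"
    using Suc occ1 unfolding M_def by (intro add_mono mult_left_mono mult_right_mono) auto
  also have "ennreal (V i0) + (ennreal (1 - lam / h) * ennreal M + 1 * ennreal (b / h))
      = ennreal (V i0 + ((1 - lam / h) * M + b / h))"
  proof -
    have "0 \<le> 1 - lam / h" using lam_le h_pos by simp
    then show ?thesis
      using M V_pos[of i0] b_nonneg h_pos by (simp add: ennreal_mult ennreal_plus)
  qed
  also have "V i0 + ((1 - lam / h) * M + b / h) = M"
    using h_pos lam_pos by (simp add: M_def field_simps)
  finally show ?case by (simp add: M_def add_left_mono)
qed simp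

text \<open>The increasing limit \<gamma> of \<open>occupation\<close> is normalized to a
  probability measure. The lower bound \<delta> of \<open>V\<close> turns the bound on its
  \<open>V\<close>-norm into finite total mass.\<close>

lemma ex_balanced:
  assumes V_lower: "0 < \<delta>" "\<And>i. \<delta> \<le> V i"
  shows "\<exists>\<mu>. balanced Q \<mu>"
proof -
  define \<gamma> where "\<gamma> j = (SUP n. occupation n j)" for j
  have inc: "incseq occupation"
    by (intro incseq_SucI le_funI occupation_mono)
  have \<gamma>_int: "(\<integral>\<^sup>+j. \<gamma> j * w j \<partial>counting) = (SUP n. \<integral>\<^sup>+j. occupation n j * w j \<partial>counting)" for w
  proof -
    have "incseq (\<lambda>n j. occupation n j * w j)"
      using inc by (auto simp: incseq_def le_fun_def intro!: mult_right_mono)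
    then show ?thesis
      unfolding \<gamma>_def SUP_mult_right_ennreal
      by (rule nn_integral_monotone_convergence_SUP) simp
  qed
  have SUP_Suc: "(SUP n. f (Suc n)) = (SUP n. f n)" if "incseq f" for f :: "nat \<Rightarrow> ennreal"
    using that by (intro antisym SUP_mono) (auto simp: incseq_def, meson le_SucI order_refl)
  have \<gamma>_suc: "\<gamma> j = (SUP n. occupation (Suc n) j)" for j
    unfolding \<gamma>_def using inc by (intro SUP_Suc[symmetric]) (simp add: incseq_def le_fun_def)
  have \<gamma>_i0: "\<gamma> i0 = 1" unfolding \<gamma>_suc by simp
  \<comment> \<open>Monotone convergence carries the recursion to the limit away from
    \<open>i0\<close>; at \<open>i0\<close> the recursion prescribes the value 1, so invariance
    there is a separate matter.\<close>
  have \<gamma>_other: "\<gamma> j = (\<integral>\<^sup>+i. \<gamma> i * ennreal (unif i j) \<partial>counting)" if "j \<noteq> i0" for j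
    unfolding \<gamma>_int unfolding \<gamma>_suc using that by simp
  define M where "M = (V i0 + b / h) * h / lam"
  define Z where "Z = (\<integral>\<^sup>+j. \<gamma> j \<partial>counting)"
  have "Z \<le> (\<integral>\<^sup>+j. ennreal (1 / \<delta>) * (\<gamma> j * ennreal (V j)) \<partial>counting)"
    unfolding Z_def
  proof (intro nn_integral_mono)
    fix j
    have "1 \<le> ennreal (1 / \<delta>) * ennreal (V j)"
      using V_lower by (simp add: ennreal_mult[symmetric] order_trans[OF _ V_lower(2)] less_imp_le)
    from mult_left_mono[OF this, of "\<gamma> j"]
    show "\<gamma> j \<le> ennreal (1 / \<delta>) * (\<gamma> j * ennreal (V j))" by (simp add: mult_ac)
  qed
  also have "\<dots> \<le> ennreal (1 / \<delta>) * ennreal M"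
    unfolding M_def by (auto simp: nn_integral_cmult \<gamma>_int intro!: mult_left_mono SUP_least occupation_V_le)
  finally have "Z \<le> ennreal (1 / \<delta>) * ennreal M" .
  moreover have "ennreal (1 / \<delta>) * ennreal M < \<top>" by (simp add: ennreal_mult_less_top)
  ultimately have Z_fin: "Z \<noteq> \<top>" by auto
  have Z_ge: "1 \<le> Z" using term_le_nn_integral_counting[of \<gamma> i0] \<gamma>_i0 by (simp add: Z_def)
  have \<gamma>_le: "\<gamma> j \<le> Z" for j unfolding Z_def by (rule term_le_nn_integral_counting)
  define R where "R = (\<integral>\<^sup>+j. (if j = i0 then 0 else \<gamma> j) \<partial>counting)"
  have Z_split: "Z = 1 + R"
    unfolding Z_def R_def using nn_integral_counting_split[of \<gamma> i0] by (simp add: \<gamma>_i0)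
  text \<open>Invariance at \<open>i0\<close> follows by comparing total masses.\<close>
  have "Z = (\<integral>\<^sup>+j. (\<integral>\<^sup>+i. \<gamma> i * ennreal (unif i j) \<partial>counting) * 1 \<partial>counting)"
    unfolding kernel_assoc by (simp add: unif_row_sum Z_def)
  also have "\<dots> = (\<integral>\<^sup>+i. \<gamma> i * ennreal (unif i i0) \<partial>counting) + R"
  proof -
    have "(\<integral>\<^sup>+j. (if j = i0 then 0 else \<integral>\<^sup>+i. \<gamma> i * ennreal (unif i j) \<partial>counting) \<partial>counting) = R"
      unfolding R_def by (intro nn_integral_cong) (auto simp: \<gamma>_other[symmetric])
    then show ?thesis
      using nn_integral_counting_split[of "\<lambda>j. \<integral>\<^sup>+i. \<gamma> i * ennreal (unif i j) \<partial>counting" i0] by simp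
  qed
  finally have "R + 1 = R + (\<integral>\<^sup>+i. \<gamma> i * ennreal (unif i i0) \<partial>counting)"
    using Z_split by (simp add: add.commute)
  moreover have "R \<noteq> \<top>" using Z_fin Z_split by auto
  ultimately have "(\<integral>\<^sup>+i. \<gamma> i * ennreal (unif i i0) \<partial>counting) = \<gamma> i0"
    by (simp add: \<gamma>_i0 ennreal_add_left_cancel)
  then have inv: "(\<integral>\<^sup>+i. \<gamma> i * ennreal (unif i j) \<partial>counting) = \<gamma> j" for j
    using \<gamma>_other[of j] by (cases "j = i0") auto
  obtain z where z: "Z = ennreal z" "1 \<le> z"
    using Z_fin Z_ge by (cases Z) (auto simp: ennreal_1[symmetric] ennreal_le_iff simp del: ennreal_1)
  define g where "g j = enn2real (\<gamma> j)" for j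
  have g: "\<gamma> j = ennreal (g j)" "0 \<le> g j" for j
    using \<gamma>_le[of j] Z_fin unfolding g_def by (auto simp: ennreal_enn2real_if top_unique)
  define \<mu> where "\<mu> = embed_pmf (\<lambda>j. g j / z)"
  have "(\<integral>\<^sup>+j. ennreal (g j / z) \<partial>counting) = (\<integral>\<^sup>+j. ennreal (1 / z) * \<gamma> j \<partial>counting)"
    using z g by (intro nn_integral_cong) (simp add: ennreal_mult[symmetric])
  also have "\<dots> = 1"
    using z by (simp add: nn_integral_cmult Z_def[symmetric] ennreal_mult[symmetric])
  finally have pmf_\<mu>: "pmf \<mu> j = g j / z" for j
    unfolding \<mu>_def using g z by (intro pmf_embed_pmf) auto
  have "(\<integral>\<^sup>+i. ennreal (pmf \<mu> i * unif i j) \<partial>counting) = ennreal (pmf \<mu> j)" for j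
  proof -
    have "(\<integral>\<^sup>+i. ennreal (pmf \<mu> i * unif i j) \<partial>counting)
        = (\<integral>\<^sup>+i. ennreal (1 / z) * (\<gamma> i * ennreal (unif i j)) \<partial>counting)"
      using z g unif_nonneg by (intro nn_integral_cong) (simp add: pmf_\<mu> ennreal_mult[symmetric])
    also have "\<dots> = ennreal (1 / z) * \<gamma> j"
      by (simp add: nn_integral_cmult inv)
    finally show ?thesis using z g by (simp add: pmf_\<mu> ennreal_mult[symmetric])
  qed
  then show ?thesis by (auto simp: balanced_iff_invariant_unif)
qed

end

section \<open>Perturbation of the invariant measure\<close>

text \<open>With \<open>t\<close> chosen so that \<open>m = \<nu> - \<pi> - t \<pi>\<close> vanishes at \<open>i0\<close>, the drift condition contracts
  \<open>m\<close> without the additive term.  The total mass of \<open>m\<close> is \<open>- t\<close>, which controls \<open>t\<close> in turn.\<close>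

lemma (in drift_generator) perturbation_bound:
  assumes \<pi>: "balanced Q \<pi>" and \<nu>: "balanced Q' \<nu>"
    and Q'_bounded: "\<And>i j. \<bar>Q' i j\<bar> \<le> B"
    and \<nu>V: "(\<integral>\<^sup>+i. ennreal (pmf \<nu> i) * ennreal (V i) \<partial>counting) < \<top>"
    and D: "\<And>i. (\<integral>\<^sup>+j. ennreal \<bar>Q' i j - Q i j\<bar> * ennreal (V j) \<partial>counting) \<le> D * ennreal (V i)"
    and E: "\<And>i. 1 \<le> E * ennreal (V i)"
  shows "ennreal lam * (\<integral>\<^sup>+i. ennreal \<bar>pmf \<nu> i - pmf \<pi> i\<bar> * ennreal (V i) \<partial>counting)
    \<le> (1 + E * (\<integral>\<^sup>+i. ennreal (pmf \<pi> i) * ennreal (V i) \<partial>counting)) *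
      (D * (\<integral>\<^sup>+i. ennreal (pmf \<nu> i) * ennreal (V i) \<partial>counting))"
proof -
  define t where "t = (pmf \<nu> i0 - pmf \<pi> i0) / pmf \<pi> i0"
  define m where "m i = pmf \<nu> i - (1 + t) * pmf \<pi> i" for i
  have m_i0: "m i0 = 0"
    using pmf_pos[OF irr \<pi>, of i0] by (simp add: m_def t_def field_simps)
  define S where "S = (\<integral>\<^sup>+i. ennreal \<bar>m i\<bar> * ennreal (V i) \<partial>counting)"
  define N where "N = (\<integral>\<^sup>+i. ennreal (pmf \<nu> i) * ennreal (V i) \<partial>counting)"
  define p where "p = (\<integral>\<^sup>+i. ennreal (pmf \<pi> i) * ennreal (V i) \<partial>counting)"
  have p_fin: "p < \<top>"
    unfolding p_def using integral_V_le[OF \<pi>] by (rule le_less_trans) simp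
  have int_\<nu>Q: "integrable counting (\<lambda>i. pmf \<nu> i * Q i j)" for j
    by (rule integrable_pmf_column)
  have int_\<nu>Q': "integrable counting (\<lambda>i. pmf \<nu> i * Q' i j)" for j
    by (rule integrable_pmf_mult_bounded) (rule Q'_bounded)
  have S_fin: "S < \<top>"
  proof -
    have "S \<le> (\<integral>\<^sup>+i. (ennreal (pmf \<nu> i) + ennreal \<bar>1 + t\<bar> * ennreal (pmf \<pi> i)) * ennreal (V i) \<partial>counting)"
      unfolding S_def
    proof (intro nn_integral_mono mult_right_mono)
      fix i
      have "\<bar>m i\<bar> \<le> pmf \<nu> i + \<bar>1 + t\<bar> * pmf \<pi> i"
        unfolding m_def using abs_triangle_ineq4[of "pmf \<nu> i" "(1 + t) * pmf \<pi> i"] by (simp add: abs_mult)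
      then have "ennreal \<bar>m i\<bar> \<le> ennreal (pmf \<nu> i + \<bar>1 + t\<bar> * pmf \<pi> i)" by (rule ennreal_leI)
      then show "ennreal \<bar>m i\<bar> \<le> ennreal (pmf \<nu> i) + ennreal \<bar>1 + t\<bar> * ennreal (pmf \<pi> i)"
        by (simp add: ennreal_mult)
    qed simp
    also have "\<dots> = N + ennreal \<bar>1 + t\<bar> * p"
      by (simp add: distrib_right nn_integral_add nn_integral_cmult N_def p_def mult.assoc)
    also have "\<dots> < \<top>" using \<nu>V p_fin by (simp add: N_def ennreal_mult_less_top)
    finally show ?thesis .
  qed
  \<comment> \<open>Since \<pi> Q and \<nu> Q' vanish, m Q = \<nu> Q = - \<nu> (Q' - Q). Hence m = m
    \<open>unif\<close> + \<nu> (Q' - Q) / h, and absolute values are taken entrywise.\<close>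
  have m_le: "ennreal \<bar>m j\<bar> \<le> (\<integral>\<^sup>+i. ennreal \<bar>m i\<bar> * ennreal (unif i j) \<partial>counting)
      + ennreal (1 / h) * (\<integral>\<^sup>+i. ennreal (pmf \<nu> i) * ennreal \<bar>Q' i j - Q i j\<bar> \<partial>counting)" for j
  proof -
    define a where "a i = pmf \<nu> i * (Q' i j - Q i j)" for i
    have a: "integrable counting a" "(\<integral>i. a i \<partial>counting) = - (\<integral>i. pmf \<nu> i * Q i j \<partial>counting)"
      unfolding a_def using int_\<nu>Q[of j] int_\<nu>Q'[of j] \<nu>
      by (simp_all add: right_diff_distrib balanced_def)
    have "(\<lambda>i. m i * Q i j) = (\<lambda>i. pmf \<nu> i * Q i j - (1 + t) * (pmf \<pi> i * Q i j))"
      by (simp add: m_def algebra_simps)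
    then have mQ: "integrable counting (\<lambda>i. m i * Q i j)"
      "(\<integral>i. m i * Q i j \<partial>counting) = (\<integral>i. pmf \<nu> i * Q i j \<partial>counting)"
      using int_\<nu>Q[of j] integrable_pmf_column[of \<pi> j] \<pi> by (simp_all add: balanced_def)
    then have mQh: "integrable counting (\<lambda>i. m i * Q i j / h)"
      "(\<integral>i. m i * Q i j / h \<partial>counting) = (\<integral>i. pmf \<nu> i * Q i j \<partial>counting) / h"
      by simp_all
    have unif_eq: "(\<lambda>i. m i * unif i j) = (\<lambda>i. (if i = j then m i else 0) + m i * Q i j / h)"
      by (auto simp: unif_def distrib_left)
    have "(\<integral>i. m i * unif i j \<partial>counting) = m j + (\<integral>i. pmf \<nu> i * Q i j \<partial>counting) / h"
      unfolding unif_eq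
      using Bochner_Integration.integral_add[OF integral_counting_single(1)[of j m] mQh(1)]
      by (simp only: integral_counting_single(2)[of j m] mQh(2))
    then have m_eq: "m j = (\<integral>i. m i * unif i j \<partial>counting) + (\<integral>i. a i \<partial>counting) / h"
      using a(2) by simp
    have "\<bar>m j\<bar> \<le> \<bar>\<integral>i. m i * unif i j \<partial>counting\<bar> + 1 / h * \<bar>\<integral>i. a i \<partial>counting\<bar>"
      unfolding m_eq using h_pos abs_triangle_ineq[of "\<integral>i. m i * unif i j \<partial>counting" "(\<integral>i. a i \<partial>counting) / h"]
      by simp
    then have "ennreal \<bar>m j\<bar> \<le> ennreal (\<bar>\<integral>i. m i * unif i j \<partial>counting\<bar> + 1 / h * \<bar>\<integral>i. a i \<partial>counting\<bar>)"
      by (rule ennreal_leI)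
    also have "\<dots> = ennreal \<bar>\<integral>i. m i * unif i j \<partial>counting\<bar> + ennreal (1 / h) * ennreal \<bar>\<integral>i. a i \<partial>counting\<bar>"
      using h_pos by (simp only: ennreal_plus abs_ge_zero ennreal_mult' zero_le_divide_1_iff less_imp_le mult_nonneg_nonneg)
    also have "\<dots> \<le> (\<integral>\<^sup>+i. ennreal \<bar>m i * unif i j\<bar> \<partial>counting) + ennreal (1 / h) * (\<integral>\<^sup>+i. ennreal \<bar>a i\<bar> \<partial>counting)"
      by (intro add_mono mult_left_mono abs_integral_counting_le) simp
    also have "\<dots> = (\<integral>\<^sup>+i. ennreal \<bar>m i\<bar> * ennreal (unif i j) \<partial>counting)
        + ennreal (1 / h) * (\<integral>\<^sup>+i. ennreal (pmf \<nu> i) * ennreal \<bar>Q' i j - Q i j\<bar> \<partial>counting)"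
      unfolding a_def abs_mult using unif_nonneg by (simp add: ennreal_mult)
    finally show ?thesis .
  qed
  define X where "X = ennreal (1 / h) * (D * N)"
  \<comment> \<open>\<open>S\<close> stands on both sides because the drift inequality is used
    without subtraction; \<open>S_fin\<close> allows cancelling it afterwards.\<close>
  have S_le: "S + ennreal (lam / h) * S \<le> S + X"
  proof -
    have "S \<le> (\<integral>\<^sup>+j. ((\<integral>\<^sup>+i. ennreal \<bar>m i\<bar> * ennreal (unif i j) \<partial>counting)
        + ennreal (1 / h) * (\<integral>\<^sup>+i. ennreal (pmf \<nu> i) * ennreal \<bar>Q' i j - Q i j\<bar> \<partial>counting)) * ennreal (V j) \<partial>counting)"
      unfolding S_def by (intro nn_integral_mono mult_right_mono m_le) simp
    also have "\<dots> = (\<integral>\<^sup>+j. (\<integral>\<^sup>+i. ennreal \<bar>m i\<bar> * ennreal (unif i j) \<partial>counting) * ennreal (V j) \<partial>counting)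
        + ennreal (1 / h) * (\<integral>\<^sup>+j. (\<integral>\<^sup>+i. ennreal (pmf \<nu> i) * ennreal \<bar>Q' i j - Q i j\<bar> \<partial>counting) * ennreal (V j) \<partial>counting)"
      by (simp only: distrib_right nn_integral_add nn_integral_cmult borel_measurable_count_space mult.assoc)
    also have "\<dots> = (\<integral>\<^sup>+i. ennreal \<bar>m i\<bar> * (\<integral>\<^sup>+j. ennreal (unif i j) * ennreal (V j) \<partial>counting) \<partial>counting)
        + ennreal (1 / h) * (\<integral>\<^sup>+i. ennreal (pmf \<nu> i) * (\<integral>\<^sup>+j. ennreal \<bar>Q' i j - Q i j\<bar> * ennreal (V j) \<partial>counting) \<partial>counting)"
      by (simp only: kernel_assoc)
    also have "\<dots> \<le> (\<integral>\<^sup>+i. ennreal \<bar>m i\<bar> * (\<integral>\<^sup>+j. ennreal (unif i j) * ennreal (V j) \<partial>counting) \<partial>counting)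
        + ennreal (1 / h) * (\<integral>\<^sup>+i. ennreal (pmf \<nu> i) * (D * ennreal (V i)) \<partial>counting)"
      by (intro add_left_mono mult_left_mono nn_integral_mono D) simp_all
    also have "(\<integral>\<^sup>+i. ennreal (pmf \<nu> i) * (D * ennreal (V i)) \<partial>counting) = D * N"
      unfolding N_def by (subst nn_integral_cmult[symmetric]) (simp_all add: mult.left_commute)
    finally have "S + ennreal (lam / h) * S
        \<le> (\<integral>\<^sup>+i. ennreal \<bar>m i\<bar> * (\<integral>\<^sup>+j. ennreal (unif i j) * ennreal (V j) \<partial>counting) \<partial>counting) + X
          + ennreal (lam / h) * S"
      unfolding X_def by (rule add_right_mono)
    also have "\<dots> = (\<integral>\<^sup>+i. ennreal \<bar>m i\<bar> * ((\<integral>\<^sup>+j. ennreal (unif i j) * ennreal (V j) \<partial>counting)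
          + ennreal (lam / h) * ennreal (V i)) \<partial>counting) + X"
    proof -
      have "ennreal (lam / h) * S = (\<integral>\<^sup>+i. ennreal \<bar>m i\<bar> * (ennreal (lam / h) * ennreal (V i)) \<partial>counting)"
        unfolding S_def by (subst nn_integral_cmult[symmetric]) (simp_all add: mult.left_commute)
      then show ?thesis
        by (simp add: distrib_left nn_integral_add add_ac)
    qed
    also have "\<dots> \<le> (\<integral>\<^sup>+i. ennreal \<bar>m i\<bar> * ennreal (V i) \<partial>counting) + X"
    proof (intro add_right_mono nn_integral_mono)
      fix i
      have "ennreal \<bar>m i\<bar> * ((\<integral>\<^sup>+j. ennreal (unif i j) * ennreal (V j) \<partial>counting) + ennreal (lam / h) * ennreal (V i))
          \<le> ennreal \<bar>m i\<bar> * (ennreal (V i) + (if i = i0 then ennreal (b / h) else 0))"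
        by (intro mult_left_mono drift_unif') simp
      \<comment> \<open>The choice of \<open>t\<close> pays off: the additive term sits at
        \<open>i0\<close>, where \<open>m\<close> is 0.\<close>
      also have "\<dots> = ennreal \<bar>m i\<bar> * ennreal (V i)"
        using m_i0 by auto
      finally show "ennreal \<bar>m i\<bar> * ((\<integral>\<^sup>+j. ennreal (unif i j) * ennreal (V j) \<partial>counting) + ennreal (lam / h) * ennreal (V i))
          \<le> ennreal \<bar>m i\<bar> * ennreal (V i)" .
    qed
    finally show ?thesis unfolding S_def .
  qed
  have lam_S: "ennreal lam * S \<le> D * N"
  proof -
    have "ennreal (lam / h) * S \<le> X" using S_le S_fin by (auto simp: ennreal_add_left_cancel_le)
    then have "ennreal h * (ennreal (lam / h) * S) \<le> ennreal h * X" by (rule mult_left_mono) simp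
    moreover have "ennreal h * ennreal (lam / h) = ennreal lam" "ennreal h * ennreal (1 / h) = 1"
      using h_pos lam_pos by (simp_all add: ennreal_mult[symmetric])
    ultimately show ?thesis by (simp add: X_def mult.assoc[symmetric])
  qed
  \<comment> \<open>The integral of \<open>m\<close> is 1 - (1 + t) = - t; the hypothesis on
    \<open>E\<close> compares unweighted mass with the \<open>V\<close>-norm.\<close>
  have t_le: "ennreal \<bar>t\<bar> \<le> E * S"
  proof -
    have m_int: "(\<integral>i. m i \<partial>counting) = - t"
      unfolding m_def by (simp add: integrable_pmf integral_pmf)
    have "ennreal \<bar>t\<bar> \<le> (\<integral>\<^sup>+i. ennreal \<bar>m i\<bar> \<partial>counting)"
      using abs_integral_counting_le[of m] by (simp add: m_int)
    also have "\<dots> \<le> (\<integral>\<^sup>+i. E * (ennreal \<bar>m i\<bar> * ennreal (V i)) \<partial>counting)"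
      using mult_left_mono[OF E, of "ennreal \<bar>m _\<bar>"]
      by (intro nn_integral_mono) (simp add: mult.left_commute)
    also have "\<dots> = E * S" by (simp add: nn_integral_cmult S_def)
    finally show ?thesis .
  qed
  have "(\<integral>\<^sup>+i. ennreal \<bar>pmf \<nu> i - pmf \<pi> i\<bar> * ennreal (V i) \<partial>counting)
      \<le> (\<integral>\<^sup>+i. (ennreal \<bar>m i\<bar> + ennreal \<bar>t\<bar> * ennreal (pmf \<pi> i)) * ennreal (V i) \<partial>counting)"
  proof (intro nn_integral_mono mult_right_mono)
    fix i
    have "pmf \<nu> i - pmf \<pi> i = m i + t * pmf \<pi> i" by (simp add: m_def algebra_simps)
    then have "\<bar>pmf \<nu> i - pmf \<pi> i\<bar> \<le> \<bar>m i\<bar> + \<bar>t\<bar> * pmf \<pi> i"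
      using abs_triangle_ineq[of "m i" "t * pmf \<pi> i"] by (simp add: abs_mult)
    then have "ennreal \<bar>pmf \<nu> i - pmf \<pi> i\<bar> \<le> ennreal (\<bar>m i\<bar> + \<bar>t\<bar> * pmf \<pi> i)" by (rule ennreal_leI)
    then show "ennreal \<bar>pmf \<nu> i - pmf \<pi> i\<bar> \<le> ennreal \<bar>m i\<bar> + ennreal \<bar>t\<bar> * ennreal (pmf \<pi> i)"
      by (simp add: ennreal_mult)
  qed simp
  also have "\<dots> = S + ennreal \<bar>t\<bar> * p"
    by (simp add: distrib_right nn_integral_add nn_integral_cmult S_def p_def mult.assoc)
  \<comment> \<open>Adding back t \<pi> costs the factor 1 + E p; this is where the constant c comes
    from.\<close>
  also have "\<dots> \<le> S + E * S * p"
    by (intro add_left_mono mult_right_mono t_le) simp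
  also have "\<dots> = (1 + E * p) * S" by (simp add: distrib_left distrib_right mult_ac)
  finally have "ennreal lam * (\<integral>\<^sup>+i. ennreal \<bar>pmf \<nu> i - pmf \<pi> i\<bar> * ennreal (V i) \<partial>counting)
      \<le> ennreal lam * ((1 + E * p) * S)"
    by (rule mult_left_mono) simp
  also have "\<dots> = (1 + E * p) * (ennreal lam * S)" by (rule mult.left_commute)
  also have "\<dots> \<le> (1 + E * p) * (D * N)" by (intro mult_left_mono lam_S) simp
  finally show ?thesis by (simp add: p_def N_def)
qed

section \<open>Positive recurrence\<close>

lemma markov_chainD:
  fixes t :: "nat \<Rightarrow> real"
  assumes mc: "markov_chain Q P X"
    and t: "0 \<le> t 0" "\<And>k. k < n \<Longrightarrow> t k < t (Suc k)" "t n < u"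
  shows "measure (P i) {\<omega>\<in>space (P i). (\<forall>k\<le>n. X (t k) \<omega> = s k) \<and> X u \<omega> = j} =
    measure (P i) {\<omega>\<in>space (P i). \<forall>k\<le>n. X (t k) \<omega> = s k} * transition_function Q (u - t n) (s n) j"
proof -
  have "\<forall>i (n::nat) (t::nat \<Rightarrow> real) s u j.
      0 \<le> t 0 \<longrightarrow> (\<forall>k<n. t k < t (Suc k)) \<longrightarrow> t n < u \<longrightarrow>
      measure (P i) {\<omega>\<in>space (P i). (\<forall>k\<le>n. X (t k) \<omega> = s k) \<and> X u \<omega> = j} =
      measure (P i) {\<omega>\<in>space (P i). \<forall>k\<le>n. X (t k) \<omega> = s k} * transition_function Q (u - t n) (s n) j"
    using mc unfolding markov_chain_def by (elim conjE)
  from this[rule_format, of t n u i s j] t show ?thesis by blast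
qed

text \<open>The Markov property along the skeleton \<open>0, d, 2 d, \<dots>\<close>, for an event determined by the first
  \<open>n + 1\<close> skeleton positions: such an event is a countable union of cylinders.\<close>

lemma markov_chain_skeleton:
  fixes P :: "'a::countable \<Rightarrow> 'w measure"
  assumes mc: "markov_chain Q P X" and d: "0 < d"
    and dep: "\<And>s s'. (\<And>k. k \<le> n \<Longrightarrow> s k = s' k) \<Longrightarrow> B s \<longleftrightarrow> B s'"
  shows "emeasure (P i) {\<omega>\<in>space (P i). B (\<lambda>k. X (d * real k) \<omega>) \<and> X (d * real n) \<omega> = a \<and> X (d * real (Suc n)) \<omega> = j}
    = emeasure (P i) {\<omega>\<in>space (P i). B (\<lambda>k. X (d * real k) \<omega>) \<and> X (d * real n) \<omega> = a}
      * ennreal (transition_function Q d a j)"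
proof -
  interpret prob_space "P i" using mc by (simp add: markov_chain_def)
  define Y where "Y k \<omega> = X (d * real k) \<omega>" for k \<omega>
  have Y[measurable]: "Y k \<in> measurable (P i) (count_space UNIV)" for k
    using mc d unfolding markov_chain_def Y_def by simp
  \<comment> \<open>Trajectories are represented by functions on the first n + 1 times,
    \<open>undefined\<close> elsewhere; there are countably many, and distinct ones give disjoint
    cylinders.\<close>
  define F where "F = {s \<in> PiE {..n} (\<lambda>_. UNIV :: 'a set). B s \<and> s n = a}"
  have F: "countable F"
    unfolding F_def by (rule countable_subset[OF _ countable_PiE[of "{..n}" "\<lambda>_. UNIV"]]) auto
  define cyl where "cyl s = {\<omega>\<in>space (P i). \<forall>k\<le>n. Y k \<omega> = s k}" for s
  have cyl_sets[measurable]: "cyl s \<in> sets (P i)" for s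
    unfolding cyl_def by measurable
  define next_j where "next_j = {\<omega>\<in>space (P i). Y (Suc n) \<omega> = j}"
  have next_sets[measurable]: "next_j \<in> sets (P i)"
    unfolding next_j_def by measurable
  have disj: "disjoint_family_on cyl F"
  proof (unfold disjoint_family_on_def, intro ballI impI)
    fix s s' assume "s \<in> F" "s' \<in> F" "s \<noteq> s'"
    then obtain k where "k \<le> n" "s k \<noteq> s' k"
      unfolding F_def by (metis (mono_tags, lifting) PiE_ext atMost_iff mem_Collect_eq)
    then show "cyl s \<inter> cyl s' = {}" by (auto simp: cyl_def)
  qed
  have event: "{\<omega>\<in>space (P i). B (\<lambda>k. Y k \<omega>) \<and> Y n \<omega> = a} = (\<Union>s\<in>F. cyl s)"
  proof (intro set_eqI iffI)
    fix \<omega> assume "\<omega> \<in> {\<omega>\<in>space (P i). B (\<lambda>k. Y k \<omega>) \<and> Y n \<omega> = a}"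
    moreover have "B (restrict (\<lambda>k. Y k \<omega>) {..n}) \<longleftrightarrow> B (\<lambda>k. Y k \<omega>)"
      by (rule dep) simp
    ultimately have "restrict (\<lambda>k. Y k \<omega>) {..n} \<in> F" "\<omega> \<in> cyl (restrict (\<lambda>k. Y k \<omega>) {..n})"
      by (auto simp: F_def cyl_def)
    then show "\<omega> \<in> (\<Union>s\<in>F. cyl s)" by blast
  next
    fix \<omega> assume "\<omega> \<in> (\<Union>s\<in>F. cyl s)"
    then obtain s where "s \<in> F" "\<omega> \<in> cyl s" by blast
    moreover from this have "B (\<lambda>k. Y k \<omega>) \<longleftrightarrow> B s"
      by (intro dep) (auto simp: cyl_def)
    ultimately show "\<omega> \<in> {\<omega>\<in>space (P i). B (\<lambda>k. Y k \<omega>) \<and> Y n \<omega> = a}"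
      by (auto simp: F_def cyl_def)
  qed
  have cyl_next: "emeasure (P i) (cyl s \<inter> next_j) = emeasure (P i) (cyl s) * ennreal (transition_function Q d a j)"
    if "s \<in> F" for s
  proof -
    have "measure (P i) {\<omega>\<in>space (P i). (\<forall>k\<le>n. X (d * real k) \<omega> = s k) \<and> X (d * real (Suc n)) \<omega> = j}
        = measure (P i) {\<omega>\<in>space (P i). \<forall>k\<le>n. X (d * real k) \<omega> = s k} *
          transition_function Q (d * real (Suc n) - d * real n) (s n) j"
      using markov_chainD[OF mc, of "\<lambda>k. d * real k" n "d * real (Suc n)" i s j] d by simp
    moreover have "cyl s \<inter> next_j = {\<omega>\<in>space (P i). (\<forall>k\<le>n. X (d * real k) \<omega> = s k) \<and> X (d * real (Suc n)) \<omega> = j}"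
      by (auto simp: cyl_def next_j_def Y_def)
    moreover have "d * real (Suc n) - d * real n = d" by (simp add: algebra_simps)
    moreover have "s n = a" using that by (simp add: F_def)
    ultimately show ?thesis
      by (simp add: emeasure_eq_measure cyl_def Y_def ennreal_mult')
  qed
  have "{\<omega>\<in>space (P i). B (\<lambda>k. Y k \<omega>) \<and> Y n \<omega> = a \<and> Y (Suc n) \<omega> = j}
      = {\<omega>\<in>space (P i). B (\<lambda>k. Y k \<omega>) \<and> Y n \<omega> = a} \<inter> next_j"
    by (auto simp: next_j_def)
  also have "\<dots> = (\<Union>s\<in>F. cyl s \<inter> next_j)"
    unfolding event by blast
  also have "emeasure (P i) \<dots> = (\<integral>\<^sup>+s. emeasure (P i) (cyl s \<inter> next_j) \<partial>count_space F)"
    using disj F by (intro emeasure_UN_countable) (auto simp: disjoint_family_on_def)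
  also have "\<dots> = (\<integral>\<^sup>+s. emeasure (P i) (cyl s) * ennreal (transition_function Q d a j) \<partial>count_space F)"
    by (intro nn_integral_cong cyl_next) simp
  also have "\<dots> = (\<integral>\<^sup>+s. emeasure (P i) (cyl s) \<partial>count_space F) * ennreal (transition_function Q d a j)"
    by (simp add: nn_integral_multc)
  also have "(\<integral>\<^sup>+s. emeasure (P i) (cyl s) \<partial>count_space F) = emeasure (P i) (\<Union>s\<in>F. cyl s)"
    using disj F by (intro emeasure_UN_countable[symmetric]) auto
  finally show ?thesis
    by (simp only: event[symmetric]) (simp only: Y_def)
qed

text \<open>The entry is a probability: the Markov property at the single time 0 identifies it with
  the probability of moving from \<open>i\<close> to \<open>j\<close> by time \<open>t\<close>. The
  terms of the exponential series may have either sign.\<close>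

lemma markov_chain_transition_nonneg:
  assumes mc: "markov_chain Q P X" and t: "0 < t"
  shows "0 \<le> transition_function Q t i j"
proof -
  have "measure (P i) {\<omega>\<in>space (P i). (\<forall>k\<le>0. X (real k) \<omega> = (\<lambda>_. i) k) \<and> X t \<omega> = j}
      = measure (P i) {\<omega>\<in>space (P i). \<forall>k\<le>0. X (real k) \<omega> = (\<lambda>_. i) k} *
        transition_function Q (t - real 0) ((\<lambda>_. i) 0) j"
    using markov_chainD[OF mc, of real 0 t i "\<lambda>_. i" j] t by simp
  moreover have "measure (P i) {\<omega>\<in>space (P i). X 0 \<omega> = i} = 1"
    using mc by (simp add: markov_chain_def)
  ultimately have "transition_function Q t i j = measure (P i) {\<omega>\<in>space (P i). X 0 \<omega> = i \<and> X t \<omega> = j}"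
    by simp
  then show ?thesis by simp
qed

section \<open>Returns to a state along the skeleton\<close>

text \<open>A return presupposes that the path has left \<open>i\<close>, just as
  \<open>return_time\<close> looks only at times from the first jump on. An initial stay in
  \<open>i\<close> is therefore allowed.\<close>

definition no_return :: "'a \<Rightarrow> nat \<Rightarrow> (nat \<Rightarrow> 'a) \<Rightarrow> bool" where
  "no_return i n s \<longleftrightarrow> s 0 = i \<and> \<not> (\<exists>m l. m < l \<and> l \<le> n \<and> s m \<noteq> i \<and> s l = i)"

lemma no_return_cong: "(\<And>k. k \<le> n \<Longrightarrow> s k = s' k) \<Longrightarrow> no_return i n s \<longleftrightarrow> no_return i n s'"
  unfolding no_return_def by (metis le_trans less_imp_le zero_le)

text \<open>A step that ends outside \<open>i\<close> cannot complete a return.\<close>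

lemma no_return_Suc_other:
  "j \<noteq> i \<Longrightarrow> no_return i (Suc n) s \<and> s (Suc n) = j \<longleftrightarrow> no_return i n s \<and> s (Suc n) = j"
  unfolding no_return_def by (auto simp: le_Suc_eq)

text \<open>A path in \<open>i\<close> that has not returned has not left \<open>i\<close> at all,
  so it was in \<open>i\<close> one step before.\<close>

lemma no_return_Suc_same:
  "no_return i (Suc n) s \<and> s (Suc n) = i \<longleftrightarrow> no_return i n s \<and> s n = i \<and> s (Suc n) = i"
proof
  assume a: "no_return i (Suc n) s \<and> s (Suc n) = i"
  then have "s n = i" unfolding no_return_def by (metis lessI order_refl)
  then show "no_return i n s \<and> s n = i \<and> s (Suc n) = i"
    using a unfolding no_return_def by (auto simp: le_Suc_eq)
next
  assume a: "no_return i n s \<and> s n = i \<and> s (Suc n) = i"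
  have False if "m < l" "l \<le> Suc n" "s m \<noteq> i" "s l = i" for m l
  proof (cases "l = Suc n")
    case True
    then have "m < n" using that a by (metis less_SucE)
    then show False using a that(3) unfolding no_return_def by blast
  next
    case False
    then show False using a that unfolding no_return_def by (auto simp: le_Suc_eq)
  qed
  then show "no_return i (Suc n) s \<and> s (Suc n) = i"
    using a unfolding no_return_def by blast
qed

text \<open>If \<open>N\<close> is the first index at which \<open>no_return\<close> fails, the
  skeleton was outside \<open>i\<close> at some time d m and back in \<open>i\<close> at a later
  time d l with l \<le> N. So the first jump occurs by d m and the return by d l, while the sum is
  at least \<open>N\<close>. If it never fails, the right side is infinite.\<close>

lemma return_time_le_skeleton:
  assumes d: "0 < d" and start: "X 0 \<omega> = i"
  shows "return_time X i \<omega> \<le> ennreal d * (\<Sum>n. if no_return i n (\<lambda>k. X (d * real k) \<omega>) then 1 else 0)"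
    (is "_ \<le> _ * (\<Sum>n. ?f n)")
proof -
  have ge: "of_nat N \<le> (\<Sum>n. ?f n)" if "\<And>n. n < N \<Longrightarrow> no_return i n (\<lambda>k. X (d * real k) \<omega>)" for N
  proof -
    have "of_nat N = (\<Sum>n<N. ?f n)" using that by simp
    also have "\<dots> \<le> (\<Sum>n. ?f n)" by (rule sum_le_suminf) auto
    finally show ?thesis .
  qed
  show ?thesis
  proof (cases "\<forall>n. no_return i n (\<lambda>k. X (d * real k) \<omega>)")
    case True
    then have "(SUP N. of_nat N) \<le> (\<Sum>n. ?f n)" by (intro SUP_least ge) auto
    then have "(\<Sum>n. ?f n) = \<top>" by (simp only: ennreal_SUP_of_nat_eq_top top_unique)
    then show ?thesis using d by (simp add: ennreal_mult_top)
  next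
    case False
    define N where "N = (LEAST n. \<not> no_return i n (\<lambda>k. X (d * real k) \<omega>))"
    have N: "\<not> no_return i N (\<lambda>k. X (d * real k) \<omega>)"
      unfolding N_def using False by (metis (mono_tags, lifting) LeastI)
    have before: "no_return i n (\<lambda>k. X (d * real k) \<omega>)" if "n < N" for n
      using not_less_Least[OF that[unfolded N_def]] by simp
    from N start obtain m l where ml: "m < l" "l \<le> N" "X (d * real m) \<omega> \<noteq> i" "X (d * real l) \<omega> = i"
      by (auto simp: no_return_def)
    have "first_jump_time X \<omega> \<le> ennreal (d * real m)"
      unfolding first_jump_time_def using ml d start by (intro INF_lower) auto
    also have "\<dots> \<le> ennreal (d * real l)"
      using ml d by (intro ennreal_leI) simp
    finally have "return_time X i \<omega> \<le> ennreal (d * real l)"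
      unfolding return_time_def using ml d by (intro INF_lower) auto
    also have "\<dots> \<le> ennreal (d * real N)"
      using ml d by (intro ennreal_leI) simp
    also have "\<dots> = ennreal d * of_nat N"
      using d by (simp add: ennreal_mult ennreal_of_nat_eq_real_of_nat)
    also have "\<dots> \<le> ennreal d * (\<Sum>n. ?f n)"
      by (intro mult_left_mono ge before) auto
    finally show ?thesis .
  qed
qed

text \<open>A Kac-type argument: the expected occupation measure of the skeleton chain until its first
  return to \<open>i\<close> is bounded by a multiple of the invariant probability measure.\<close>

lemma (in bounded_generator) positive_recurrent_if_balanced:
  assumes irr: "irreducible_matrix Q" and mc: "markov_chain Q P X" and bal: "balanced Q \<nu>"
  shows "positive_recurrent Q P X"
  unfolding positive_recurrent_def
proof (intro allI, rule disj_commute[THEN iffD1, OF disjCI])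
  fix i assume "Q i i \<noteq> 0"
  moreover have "Q i i \<le> 0"
  proof -
    have "ennreal (unif i i) \<le> 1"
      using term_le_nn_integral_counting[of "\<lambda>j. ennreal (unif i j)" i] by (simp add: unif_row_sum)
    then show ?thesis using h_pos by (simp add: unif_def field_simps)
  qed
  ultimately have Qii: "Q i i < 0" by simp
  define c where "c = (2 * h)\<^sup>2 * exp (2 * h)"
  have c: "0 \<le> c" by (simp add: c_def)
  \<comment> \<open>For this \<open>d\<close> the quadratic remainder takes at most half of the
    linear term: \<open>d * c\<close> is at most - Q i i / 2, so \<open>K i i\<close> is at most 1 +
    d Q i i / 2, which is below 1.\<close>
  define d where "d = min 1 (- Q i i / (2 * (c + 1)))"
  have d: "0 < d" "d \<le> 1" using Qii c by (auto simp: d_def intro!: divide_neg_pos)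
  define K where "K = transition_function Q d"
  have K_nonneg: "0 \<le> K k j" for k j
    unfolding K_def by (rule markov_chain_transition_nonneg[OF mc d(1)])
  have Kii: "K i i < 1"
  proof -
    have "\<bar>K i i - 1 - d * Q i i\<bar> \<le> d\<^sup>2 * c"
      using transition_function_near_identity[where Q = Q and C = "2 * h" and t = d and i = i and j = i]
        abs_row_sum_le h_pos d by (simp add: K_def c_def)
    moreover have "d * c \<le> - Q i i / 2"
    proof -
      have "d * c \<le> - Q i i / (2 * (c + 1)) * c"
        using c by (intro mult_right_mono) (auto simp: d_def)
      also have "\<dots> \<le> - Q i i / 2" using c Qii by (simp add: field_simps)
      finally show ?thesis .
    qed
    then have "d * (d * c) \<le> d * (- Q i i / 2)"
      using d(1) by (intro mult_left_mono) auto
    then have "d\<^sup>2 * c \<le> d * (- Q i i / 2)"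
      by (simp add: power2_eq_square mult.assoc)
    moreover have "d * Q i i < 0" using d Qii by (simp add: mult_pos_neg)
    ultimately show ?thesis by (simp add: abs_le_iff)
  qed
  have \<nu>K: "(\<integral>\<^sup>+k. ennreal (pmf \<nu> k) * ennreal (K k j) \<partial>counting) = ennreal (pmf \<nu> j)" for j
  proof -
    have "integrable counting (\<lambda>k. pmf \<nu> k * K k j)" "(\<integral>k. pmf \<nu> k * K k j \<partial>counting) = pmf \<nu> j"
      using balanced_imp_invariant_prob[OF bal] d
      by (simp_all add: invariant_prob_def has_sum_iff_counting K_def)
    then have "(\<integral>\<^sup>+k. ennreal (pmf \<nu> k * K k j) \<partial>counting) = ennreal (pmf \<nu> j)"
      using K_nonneg by (simp add: nn_integral_eq_integral)
    then show ?thesis using K_nonneg by (simp add: ennreal_mult)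
  qed
  interpret prob_space "P i" using mc by (simp add: markov_chain_def)
  define Y where "Y \<omega> k = X (d * real k) \<omega>" for \<omega> k
  have Y[measurable]: "(\<lambda>\<omega>. Y \<omega> k) \<in> measurable (P i) (count_space UNIV)" for k
    using mc d unfolding markov_chain_def Y_def by simp
  \<comment> \<open>Taboo probabilities: the law of the skeleton at step \<open>n\<close> on the
    event that no return has occurred.\<close>
  define q where "q n j = emeasure (P i) {\<omega>\<in>space (P i). no_return i n (Y \<omega>) \<and> Y \<omega> n = j}" for n j
  have meas[measurable]: "Measurable.pred (P i) (\<lambda>\<omega>. no_return i n (Y \<omega>))" for n
    unfolding no_return_def by measurable
  have markov: "emeasure (P i) {\<omega>\<in>space (P i). no_return i n (Y \<omega>) \<and> Y \<omega> n = k \<and> Y \<omega> (Suc n) = j} = q n k * ennreal (K k j)"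
    for n k j
    unfolding q_def K_def Y_def
    by (rule markov_chain_skeleton[OF mc d(1)]) (rule no_return_cong)
  have part: "emeasure (P i) {\<omega>\<in>space (P i). no_return i n (Y \<omega>) \<and> R \<omega>}
      = (\<integral>\<^sup>+k. emeasure (P i) {\<omega>\<in>space (P i). no_return i n (Y \<omega>) \<and> Y \<omega> n = k \<and> R \<omega>} \<partial>counting)"
    if [measurable]: "Measurable.pred (P i) R" for n R
  proof -
    have "{\<omega>\<in>space (P i). no_return i n (Y \<omega>) \<and> R \<omega>}
        = (\<Union>k. {\<omega>\<in>space (P i). no_return i n (Y \<omega>) \<and> Y \<omega> n = k \<and> R \<omega>})" by auto
    also have "emeasure (P i) \<dots>
        = (\<integral>\<^sup>+k. emeasure (P i) {\<omega>\<in>space (P i). no_return i n (Y \<omega>) \<and> Y \<omega> n = k \<and> R \<omega>} \<partial>counting)"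
    proof (rule emeasure_UN_countable)
      show "{\<omega>\<in>space (P i). no_return i n (Y \<omega>) \<and> Y \<omega> n = k \<and> R \<omega>} \<in> sets (P i)" for k
        by measurable
    qed (auto simp: disjoint_family_on_def)
    finally show ?thesis .
  qed
  have q0: "q 0 j \<le> (if j = i then 1 else 0)" for j
  proof (cases "j = i")
    case False
    then have "{\<omega>\<in>space (P i). no_return i 0 (Y \<omega>) \<and> Y \<omega> 0 = j} = {}"
      by (auto simp: no_return_def)
    then show ?thesis by (simp only: q_def emeasure_empty zero_le)
  qed (simp add: q_def emeasure_le_1)
  have q_same: "q (Suc n) i = q n i * ennreal (K i i)" for n
    unfolding markov[symmetric] unfolding q_def no_return_Suc_same ..
  have q_other: "q (Suc n) j = (\<integral>\<^sup>+k. q n k * ennreal (K k j) \<partial>counting)" if "j \<noteq> i" for n j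
  proof -
    have "q (Suc n) j = emeasure (P i) {\<omega>\<in>space (P i). no_return i n (Y \<omega>) \<and> Y \<omega> (Suc n) = j}"
      unfolding q_def no_return_Suc_other[OF that] ..
    also have "\<dots> = (\<integral>\<^sup>+k. q n k * ennreal (K k j) \<partial>counting)"
      unfolding markov[symmetric] by (rule part) measurable
    finally show ?thesis .
  qed
  have \<nu>_i: "0 < pmf \<nu> i" by (rule pmf_pos[OF irr bal])
  \<comment> \<open>\<open>C\<close> solves
    \<open>1 + C * pmf \<nu> i * K i i = C * pmf \<nu> i\<close>, which is the induction step of
    \<open>sum_q\<close> at \<open>i\<close>; at other states that step is \<nu> K = \<nu>.\<close>
  define C where "C = 1 / (pmf \<nu> i * (1 - K i i))"
  have C: "0 < C" using \<nu>_i Kii by (simp add: C_def)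
  have sum_q: "(\<Sum>n<N. q n j) \<le> ennreal (C * pmf \<nu> j)" for N j
  proof (induction N arbitrary: j)
    case (Suc N)
    have split: "(\<Sum>n<Suc N. q n j) = q 0 j + (\<Sum>n<N. q (Suc n) j)"
      by (rule sum.lessThan_Suc_shift)
    show ?case
    proof (cases "j = i")
      case True
      have "(\<Sum>n<Suc N. q n i) = q 0 i + (\<Sum>n<N. q n i) * ennreal (K i i)"
        using split True by (simp add: q_same sum_distrib_right)
      also have "\<dots> \<le> 1 + ennreal (C * pmf \<nu> i) * ennreal (K i i)"
        using q0[of i] Suc by (intro add_mono mult_right_mono) auto
      also have "\<dots> = ennreal (1 + C * pmf \<nu> i * K i i)"
        using C K_nonneg[of i i] by (simp add: ennreal_plus ennreal_mult)
      also have "1 + C * pmf \<nu> i * K i i = C * pmf \<nu> i"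
        using \<nu>_i Kii by (simp add: C_def field_simps)
      finally show ?thesis using True by simp
    next
      case False
      have "(\<Sum>n<Suc N. q n j) = (\<Sum>n<N. \<integral>\<^sup>+k. q n k * ennreal (K k j) \<partial>counting)"
        using split False q0[of j] by (simp add: q_other)
      also have "\<dots> = (\<integral>\<^sup>+k. (\<Sum>n<N. q n k) * ennreal (K k j) \<partial>counting)"
        by (simp add: nn_integral_sum[symmetric] sum_distrib_right)
      also have "\<dots> \<le> (\<integral>\<^sup>+k. ennreal (C * pmf \<nu> k) * ennreal (K k j) \<partial>counting)"
        by (intro nn_integral_mono mult_right_mono Suc) simp
      also have "\<dots> = ennreal C * (\<integral>\<^sup>+k. ennreal (pmf \<nu> k) * ennreal (K k j) \<partial>counting)"
        using C by (simp add: nn_integral_cmult[symmetric] ennreal_mult mult.assoc)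
      also have "\<dots> = ennreal (C * pmf \<nu> j)"
        using C by (simp add: \<nu>K ennreal_mult)
      finally show ?thesis .
    qed
  qed simp
  define A where "A n = {\<omega>\<in>space (P i). no_return i n (Y \<omega>)}" for n
  have [measurable]: "A n \<in> sets (P i)" for n unfolding A_def by measurable
  have A_eq: "emeasure (P i) (A n) = (\<integral>\<^sup>+j. q n j \<partial>counting)" for n
    using part[of "\<lambda>_. True" n] by (simp add: A_def q_def)
  \<comment> \<open>Summing over the states uses that \<nu> has mass 1; the mean return time is then
    at most d C.\<close>
  have total: "(\<Sum>n. emeasure (P i) (A n)) \<le> ennreal C"
  proof (rule suminf_le_const)
    fix N
    have "(\<Sum>n<N. emeasure (P i) (A n)) = (\<integral>\<^sup>+j. (\<Sum>n<N. q n j) \<partial>counting)"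
      by (simp add: A_eq nn_integral_sum)
    also have "\<dots> \<le> (\<integral>\<^sup>+j. ennreal C * ennreal (pmf \<nu> j) \<partial>counting)"
      using C sum_q by (intro nn_integral_mono) (simp add: ennreal_mult)
    also have "\<dots> = ennreal C"
      by (simp add: nn_integral_cmult nn_integral_pmf_eq_1)
    finally show "(\<Sum>n<N. emeasure (P i) (A n)) \<le> ennreal C" .
  qed simp
  have "(\<integral>\<^sup>+\<omega>. return_time X i \<omega> \<partial>P i) \<le> (\<integral>\<^sup>+\<omega>. ennreal d * (\<Sum>n. indicator (A n) \<omega>) \<partial>P i)"
  proof (rule nn_integral_mono_AE)
    have [measurable]: "X 0 \<in> measurable (P i) (count_space UNIV)" using mc by (simp add: markov_chain_def)
    have start: "prob {\<omega>\<in>space (P i). X 0 \<omega> = i} = 1" using mc by (simp add: markov_chain_def)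
    have "{\<omega>\<in>space (P i). X 0 \<omega> = i} \<in> events" by measurable
    from prob_eq_1[OF this] start have "AE \<omega> in P i. X 0 \<omega> = i" by auto
    then show "AE \<omega> in P i. return_time X i \<omega> \<le> ennreal d * (\<Sum>n. indicator (A n) \<omega>)"
    proof (rule AE_mp, intro AE_I2 impI)
      fix \<omega> assume "\<omega> \<in> space (P i)" "X 0 \<omega> = i"
      moreover have "Y \<omega> = (\<lambda>k. X (d * real k) \<omega>)" by (rule ext) (rule Y_def)
      ultimately show "return_time X i \<omega> \<le> ennreal d * (\<Sum>n. indicator (A n) \<omega>)"
        using return_time_le_skeleton[of d X \<omega> i] d
        by (simp add: A_def indicator_def of_bool_def)
    qed
  qed
  also have "(\<integral>\<^sup>+\<omega>. ennreal d * (\<Sum>n. indicator (A n) \<omega>) \<partial>P i) = ennreal d * (\<Sum>n. emeasure (P i) (A n))"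
    by (simp add: nn_integral_cmult nn_integral_suminf)
  also have "\<dots> \<le> ennreal d * ennreal C"
    by (intro mult_left_mono total) simp
  also have "\<dots> < \<infinity>" by (simp add: ennreal_mult_less_top)
  finally show "(\<integral>\<^sup>+\<omega>. return_time X i \<omega> \<partial>P i) < \<infinity>" .
qed

section \<open>The perturbed chain\<close>

lemma ennreal_divide_left_mono:
  fixes a b c :: ennreal
  assumes "b \<le> c"
  shows "a / c \<le> a / b"
proof -
  have "inverse c \<le> inverse b"
  proof (cases "b = 0 \<or> c = \<top>")
    case False
    then obtain r s where "b = ennreal r" "0 < r" "c = ennreal s"
      using assms by (cases b; cases c) (auto simp: top_unique)
    then show ?thesis using assms by (simp add: inverse_ennreal ennreal_le_iff2)
  qed auto
  then show ?thesis unfolding divide_ennreal_def by (rule mult_left_mono) simp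
qed

lemma measure_norm_eq:
  fixes V :: "'a::countable \<Rightarrow> real"
  shows "measure_norm V \<mu> = (\<integral>\<^sup>+i. ennreal \<bar>\<mu> i\<bar> * ennreal (V i) \<partial>counting)"
  by (simp add: measure_norm_def infsum_ennreal_eq_nn_integral ennreal_mult')

lemma matrix_norm_row_le:
  fixes V :: "'a::countable \<Rightarrow> real"
  assumes V: "\<And>i. 0 < V i"
  shows "(\<integral>\<^sup>+j. ennreal \<bar>L i j\<bar> * ennreal (V j) \<partial>counting) \<le> matrix_norm V L * ennreal (V i)"
proof -
  have "ennreal (1 / V i) * (\<integral>\<^sup>+j. ennreal \<bar>L i j\<bar> * ennreal (V j) \<partial>counting) \<le> matrix_norm V L"
    unfolding matrix_norm_def
    by (rule SUP_upper2[of i]) (simp_all add: infsum_ennreal_eq_nn_integral ennreal_mult')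
  from mult_right_mono[OF this, of "ennreal (V i)"]
  have "(ennreal (1 / V i) * ennreal (V i)) * (\<integral>\<^sup>+j. ennreal \<bar>L i j\<bar> * ennreal (V j) \<partial>counting)
      \<le> matrix_norm V L * ennreal (V i)" by (simp only: mult_ac zero_le)
  moreover have "ennreal (1 / V i) * ennreal (V i) = 1"
    using V[of i] by (simp add: ennreal_mult''[symmetric])
  ultimately show ?thesis by simp
qed

lemma vector_norm_one_ge:
  assumes V: "0 < V i"
  shows "1 \<le> vector_norm V (\<lambda>i. 1) * ennreal (V i)"
proof -
  have "1 = ennreal (1 / V i) * ennreal (V i)"
    using V by (simp add: ennreal_mult''[symmetric])
  also have "\<dots> \<le> vector_norm V (\<lambda>i. 1) * ennreal (V i)"
    unfolding vector_norm_def by (intro mult_right_mono SUP_upper2[of i]) auto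
  finally show ?thesis .
qed

lemma vector_norm_one_le:
  assumes V: "0 < \<delta>" "\<And>i. \<delta> \<le> V i"
  shows "vector_norm V (\<lambda>i. 1) \<le> ennreal (1 / \<delta>)"
  unfolding vector_norm_def using V order.strict_trans2[OF V(1) V(2)]
  by (auto intro!: SUP_least ennreal_leI divide_left_mono)

text \<open>The row of \<open>Q' - Q\<close> has a \<open>V\<close>-weighted sum of absolute value
  at most \<open>D * V i\<close>, so adding it preserves summability and costs at most
  \<open>D\<close> of the decay rate.\<close>

lemma drift_condition_perturbed:
  fixes Q :: "'a::countable \<Rightarrow> 'a \<Rightarrow> real"
  assumes drift: "drift_condition Q V lam b i0" and V: "\<And>i. 0 < V i" and D: "0 \<le> D"
    and row: "\<And>i. (\<integral>\<^sup>+j. ennreal \<bar>Q' i j - Q i j\<bar> * ennreal (V j) \<partial>counting) \<le> ennreal D * ennreal (V i)"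
  shows "drift_condition Q' V (lam - D) b i0"
  unfolding drift_condition_def summable_on_iff_integrable_counting infsum_eq_integral_counting
proof (intro allI conjI)
  fix i
  define f where "f j = (Q' i j - Q i j) * V j" for j
  have Vi: "0 \<le> V j" for j using V[of j] by simp
  have QV: "integrable counting (\<lambda>j. Q i j * V j)"
    and le: "(\<integral>j. Q i j * V j \<partial>counting) \<le> - lam * V i + b * indicator {i0} i"
    using drift by (simp_all add: drift_condition_def summable_on_iff_integrable_counting infsum_eq_integral_counting)
  have norm_f: "(\<integral>\<^sup>+j. ennreal \<bar>f j\<bar> \<partial>counting) \<le> ennreal (D * V i)"
    using row[of i] D Vi by (simp add: f_def abs_mult ennreal_mult)
  then have f: "integrable counting f"
    unfolding integrable_counting_iff by (rule le_less_trans) simp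
  have "ennreal \<bar>\<integral>j. f j \<partial>counting\<bar> \<le> ennreal (D * V i)"
    using abs_integral_counting_le norm_f by (rule order_trans)
  then have f_le: "\<bar>\<integral>j. f j \<partial>counting\<bar> \<le> D * V i"
    using D Vi[of i] by (simp add: ennreal_le_iff)
  have Q'_eq: "(\<lambda>j. Q' i j * V j) = (\<lambda>j. Q i j * V j + f j)"
    by (simp add: f_def algebra_simps)
  show "integrable counting (\<lambda>j. Q' i j * V j)"
    unfolding Q'_eq by (rule Bochner_Integration.integrable_add[OF QV f])
  have "(\<integral>j. Q' i j * V j \<partial>counting) = (\<integral>j. Q i j * V j \<partial>counting) + (\<integral>j. f j \<partial>counting)"
    unfolding Q'_eq by (rule Bochner_Integration.integral_add[OF QV f])
  then show "(\<integral>j. Q' i j * V j \<partial>counting) \<le> - (lam - D) * V i + b * indicator {i0} i"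
    using le f_le by (simp add: algebra_simps)
qed

section \<open>From the fixed-point inequality to the two bounds\<close>

text \<open>Over the reals this solves (lam - c D) x \<le> c D p for \<open>x\<close>. Finiteness of
  \<open>x\<close> is essential: for positive \<open>c * D\<close> the inequality also holds with
  \<open>x\<close> infinite.\<close>

lemma bound_from_fixed_point_inequality:
  fixes x c D p :: ennreal
  assumes le: "ennreal lam * x \<le> c * (D * (x + p))"
    and fin: "x < \<top>" "p < \<top>" "c < \<top>" "D < \<top>" and small: "c * D < ennreal lam" and lam: "0 < lam"
  shows "x \<le> c * p * D / (ennreal lam - c * D)"
proof -
  obtain xr where x: "x = ennreal xr" "0 \<le> xr" using fin(1) by (cases x) auto
  obtain pr where p: "p = ennreal pr" "0 \<le> pr" using fin(2) by (cases p) auto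
  obtain cr where c: "c = ennreal cr" "0 \<le> cr" using fin(3) by (cases c) auto
  obtain Dr where D: "D = ennreal Dr" "0 \<le> Dr" using fin(4) by (cases D) auto
  have "ennreal (lam * xr) \<le> ennreal (cr * (Dr * (xr + pr)))"
    using le lam x p c D by (simp add: ennreal_mult ennreal_plus)
  then have "lam * xr \<le> cr * (Dr * (xr + pr))"
    using x p c D by (simp add: ennreal_le_iff)
  moreover have "cr * Dr < lam"
    using small c D lam by (simp add: ennreal_mult[symmetric] ennreal_less_iff)
  ultimately have "xr \<le> cr * pr * Dr / (lam - cr * Dr)"
    by (simp add: field_simps)
  then have "ennreal xr \<le> ennreal (cr * pr * Dr / (lam - cr * Dr))"
    by (rule ennreal_leI)
  also have "\<dots> = c * p * D / (ennreal lam - c * D)"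
    using \<open>cr * Dr < lam\<close> x p c D by (simp add: ennreal_mult[symmetric] ennreal_minus divide_ennreal)
  finally show ?thesis by (simp add: x)
qed

text \<open>The common core of both parts. It stops at the fixed-point inequality instead of the
  solved bound because the second part first enlarges \<open>c\<close> and \<open>p\<close> before
  solving.\<close>

lemma perturbed_chain:
  fixes Q Q' :: "'a::countable \<Rightarrow> 'a \<Rightarrow> real"
  assumes Q: "intensity_matrix Q" "irreducible_matrix Q" "conservative Q" "uniformly_bounded Q"
    and Q': "intensity_matrix Q'" "irreducible_matrix Q'" "conservative Q'" "uniformly_bounded Q'"
    and chain': "markov_chain Q' P' \<Phi>'"
    and \<pi>: "invariant_prob Q \<pi>"
    and V: "0 < \<delta>" "\<And>i. \<delta> \<le> V i"
    and lam: "0 < lam" and b: "0 \<le> b"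
    and drift: "drift_condition Q V lam b i0"
  defines "p \<equiv> measure_norm V (pmf \<pi>)" and "D \<equiv> matrix_norm V (\<lambda>i j. Q' i j - Q i j)"
  defines "c \<equiv> 1 + vector_norm V (\<lambda>i. 1) * p"
  shows "p \<le> ennreal (b / lam)"
    and "D < ennreal lam / c \<Longrightarrow> positive_recurrent Q' P' \<Phi>' \<and>
      (\<exists>\<nu>. unique_invariant_prob Q' \<nu> \<and> measure_norm V (\<lambda>i. pmf \<nu> i - pmf \<pi> i) < \<top> \<and>
        ennreal lam * measure_norm V (\<lambda>i. pmf \<nu> i - pmf \<pi> i)
          \<le> c * (D * (measure_norm V (\<lambda>i. pmf \<nu> i - pmf \<pi> i) + p)))"
proof -
  have V_pos: "0 < V i" for i using V(1) V(2)[of i] by linarith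
  obtain B B' where B: "- Q i i \<le> B" and B': "- Q' i i \<le> B'" for i
    using Q(4) Q'(4) unfolding uniformly_bounded_def bdd_above_def by (metis rangeI)
  \<comment> \<open>One rate uniformizes both matrices; including \<open>lam\<close> secures
    \<open>lam \<le> h\<close>.\<close>
  define h where "h = max lam (max B B')"
  have h: "0 < h" "lam \<le> h" "- Q i i \<le> h" "- Q' i i \<le> h" for i
    using lam B[of i] B'[of i] by (auto simp: h_def)
  interpret G: drift_generator Q h V lam b i0
    using Q h V_pos lam b drift by unfold_locales auto
  have \<pi>_bal: "balanced Q \<pi>" using \<pi> by (simp add: G.invariant_prob_iff_balanced)
  show p_le: "p \<le> ennreal (b / lam)"
    unfolding p_def measure_norm_eq using G.integral_V_le[OF \<pi>_bal] by simp
  have E_fin: "vector_norm V (\<lambda>i. 1) < \<top>"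
    using vector_norm_one_le[OF V] by (rule le_less_trans) simp
  have p_fin: "p < \<top>" using p_le by (rule le_less_trans) simp
  have c_fin: "c < \<top>" using E_fin p_fin by (simp add: c_def ennreal_mult_less_top)
  have c_ge: "1 \<le> c" by (simp add: c_def)
  assume small: "D < ennreal lam / c"
  \<comment> \<open>Since \<open>c\<close> is at least 1, smallness of \<open>D\<close> also gives D
    < lam, so the drift rate lam - D of the perturbed matrix is positive.\<close>
  have "ennreal lam / c \<le> ennreal lam"
    using ennreal_divide_left_mono[OF c_ge, of "ennreal lam"] by (simp add: divide_ennreal_def)
  with small have D_lam: "D < ennreal lam" by (rule less_le_trans)
  then obtain Dr where D: "D = ennreal Dr" "0 \<le> Dr" "Dr < lam"
    by (cases D) (auto simp: ennreal_less_iff)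
  have row: "(\<integral>\<^sup>+j. ennreal \<bar>Q' i j - Q i j\<bar> * ennreal (V j) \<partial>counting) \<le> D * ennreal (V i)" for i
    unfolding D_def using V_pos by (rule matrix_norm_row_le)
  interpret G': drift_generator Q' h V "lam - Dr" b i0
  proof unfold_locales
    show "drift_condition Q' V (lam - Dr) b i0"
      using drift V_pos D(2) row unfolding D(1) by (rule drift_condition_perturbed)
  qed (use Q' h V_pos b D in auto)
  obtain \<nu> where \<nu>: "balanced Q' \<nu>" using G'.ex_balanced[OF V] by blast
  have fin: "(\<integral>\<^sup>+i. ennreal (pmf \<mu> i) * ennreal (V i) \<partial>counting) < \<top>" if "balanced Q' \<mu>" for \<mu>
    using G'.integral_V_le[OF that] by (rule le_less_trans) simp
  have E: "1 \<le> vector_norm V (\<lambda>i. 1) * ennreal (V i)" for i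
    using V_pos by (rule vector_norm_one_ge)
  \<comment> \<open>The perturbation bound is applied to two invariant measures of the same matrix,
    with \<open>D\<close> = 0.\<close>
  have unique: "\<mu> = \<nu>" if \<mu>: "balanced Q' \<mu>" for \<mu>
  proof -
    have "ennreal (lam - Dr) * (\<integral>\<^sup>+i. ennreal \<bar>pmf \<mu> i - pmf \<nu> i\<bar> * ennreal (V i) \<partial>counting)
        \<le> (1 + vector_norm V (\<lambda>i. 1) * (\<integral>\<^sup>+i. ennreal (pmf \<nu> i) * ennreal (V i) \<partial>counting)) *
          (0 * (\<integral>\<^sup>+i. ennreal (pmf \<mu> i) * ennreal (V i) \<partial>counting))"
      using \<nu> \<mu> G'.abs_entry_le fin[OF \<mu>] _ E by (rule G'.perturbation_bound) simp
    then have "(\<integral>\<^sup>+i. ennreal \<bar>pmf \<mu> i - pmf \<nu> i\<bar> * ennreal (V i) \<partial>counting) = 0"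
      using D(3) by simp
    note zero = this
    have "pmf \<mu> i = pmf \<nu> i" for i
    proof -
      have "ennreal \<bar>pmf \<mu> i - pmf \<nu> i\<bar> * ennreal (V i) \<le> 0"
        unfolding zero[symmetric] by (rule term_le_nn_integral_counting)
      moreover have "ennreal (V i) \<noteq> 0" using V_pos[of i] by (simp add: ennreal_eq_0_iff not_le)
      ultimately show ?thesis by simp
    qed
    then show ?thesis by (rule pmf_eqI)
  qed
  have unique_inv: "unique_invariant_prob Q' \<nu>"
    unfolding unique_invariant_prob_def G'.invariant_prob_iff_balanced using \<nu> unique by blast
  define x where "x = measure_norm V (\<lambda>i. pmf \<nu> i - pmf \<pi> i)"
  define N where "N = (\<integral>\<^sup>+i. ennreal (pmf \<nu> i) * ennreal (V i) \<partial>counting)"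
  have p_eq: "p = (\<integral>\<^sup>+i. ennreal (pmf \<pi> i) * ennreal (V i) \<partial>counting)"
    by (simp add: p_def measure_norm_eq)
  have "x \<le> (\<integral>\<^sup>+i. (ennreal (pmf \<nu> i) + ennreal (pmf \<pi> i)) * ennreal (V i) \<partial>counting)"
    unfolding x_def measure_norm_eq
  proof (intro nn_integral_mono mult_right_mono)
    fix i
    have "\<bar>pmf \<nu> i - pmf \<pi> i\<bar> \<le> pmf \<nu> i + pmf \<pi> i"
      using pmf_nonneg[of \<nu> i] pmf_nonneg[of \<pi> i] by linarith
    then show "ennreal \<bar>pmf \<nu> i - pmf \<pi> i\<bar> \<le> ennreal (pmf \<nu> i) + ennreal (pmf \<pi> i)"
      by (simp add: ennreal_plus[symmetric] ennreal_leI del: ennreal_plus)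
  qed simp
  also have "\<dots> = N + p"
    by (simp add: distrib_right nn_integral_add N_def p_eq)
  also have "\<dots> < \<top>" using fin[OF \<nu>] p_fin by (simp add: N_def)
  finally have x_fin: "x < \<top>" .
  \<comment> \<open>The triangle inequality replaces the norm of \<nu> by its distance to \<pi>,
    which closes the inequality in \<open>x\<close>.\<close>
  have "N \<le> (\<integral>\<^sup>+i. (ennreal \<bar>pmf \<nu> i - pmf \<pi> i\<bar> + ennreal (pmf \<pi> i)) * ennreal (V i) \<partial>counting)"
    unfolding N_def
    by (intro nn_integral_mono mult_right_mono) (auto simp: ennreal_plus[symmetric] simp del: ennreal_plus intro!: ennreal_leI)
  also have "\<dots> = x + p"
    by (simp add: distrib_right nn_integral_add x_def measure_norm_eq p_eq)
  finally have N_le: "N \<le> x + p" .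
  have "ennreal lam * x \<le> c * (D * N)"
    unfolding x_def measure_norm_eq c_def p_eq N_def
    using \<pi>_bal \<nu> G'.abs_entry_le fin[OF \<nu>] row E by (rule G.perturbation_bound)
  also have "\<dots> \<le> c * (D * (x + p))"
    by (intro mult_left_mono N_le) auto
  finally have "ennreal lam * x \<le> c * (D * (x + p))" .
  then show "positive_recurrent Q' P' \<Phi>' \<and>
      (\<exists>\<nu>. unique_invariant_prob Q' \<nu> \<and> measure_norm V (\<lambda>i. pmf \<nu> i - pmf \<pi> i) < \<top> \<and>
        ennreal lam * measure_norm V (\<lambda>i. pmf \<nu> i - pmf \<pi> i)
          \<le> c * (D * (measure_norm V (\<lambda>i. pmf \<nu> i - pmf \<pi> i) + p)))"
    using unique_inv x_fin G'.positive_recurrent_if_balanced[OF Q'(2) chain' \<nu>] unfolding x_def by blast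
qed

theorem theorem4p2:
  fixes Q Q' \<Delta> :: "'a::countable \<Rightarrow> 'a \<Rightarrow> real"
    and P :: "'a \<Rightarrow> 'w measure" and \<Phi> :: "real \<Rightarrow> 'w \<Rightarrow> 'a"
    and P' :: "'a \<Rightarrow> 'v measure" and \<Phi>' :: "real \<Rightarrow> 'v \<Rightarrow> 'a"
    and \<pi> :: "'a pmf" and i0 :: 'a and V :: "'a \<Rightarrow> real" and lam b :: real
  assumes Q: "intensity_matrix Q" "irreducible_matrix Q" "conservative Q" "uniformly_bounded Q"
    and Q': "intensity_matrix Q'" "irreducible_matrix Q'" "conservative Q'" "uniformly_bounded Q'"
    and chain: "markov_chain Q P \<Phi>"
    and chain': "markov_chain Q' P' \<Phi>'"
    and \<Delta>: "\<Delta> = (\<lambda>i j. Q' i j - Q i j)"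
    and pos_rec: "positive_recurrent Q P \<Phi>"
    and \<pi>: "unique_invariant_prob Q \<pi>"
    and V: "\<exists>\<delta>>0. \<forall>i. \<delta> \<le> V i"
    and lam: "0 < lam" and b: "0 < b"
    and drift: "drift_condition Q V lam b i0"
  shows
    "(let c = 1 + vector_norm V (\<lambda>i. 1) * measure_norm V (pmf \<pi>) in
        matrix_norm V \<Delta> < ennreal lam / c \<longrightarrow>
        positive_recurrent Q' P' \<Phi>' \<and>
        (\<exists>\<nu>. unique_invariant_prob Q' \<nu> \<and>
           measure_norm V (\<lambda>i. pmf \<nu> i - pmf \<pi> i)
             \<le> c * measure_norm V (pmf \<pi>) * matrix_norm V \<Delta>
                / (ennreal lam - c * matrix_norm V \<Delta>)))
     \<and>
     (\<forall>\<nu>. positive_recurrent Q' P' \<Phi>' \<longrightarrow> unique_invariant_prob Q' \<nu> \<longrightarrow>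
        (\<forall>i. 1 \<le> V i) \<longrightarrow>
        matrix_norm V \<Delta> < ennreal (lam\<^sup>2 / (b + lam)) \<longrightarrow>
        measure_norm V (\<lambda>i. pmf \<nu> i - pmf \<pi> i)
          \<le> ennreal (b * (b + lam)) * matrix_norm V \<Delta>
             / (ennreal (lam ^ 3) - ennreal (lam * (b + lam)) * matrix_norm V \<Delta>))"
proof -
  obtain \<delta> where \<delta>: "0 < \<delta>" "\<And>i. \<delta> \<le> V i" using V by blast
  have inv_\<pi>: "invariant_prob Q \<pi>" using \<pi> by (simp add: unique_invariant_prob_def)
  define p where "p = measure_norm V (pmf \<pi>)"
  define E where "E = vector_norm V (\<lambda>i. 1)"
  define D where "D = matrix_norm V \<Delta>"
  define x where "x \<nu> = measure_norm V (\<lambda>i. pmf \<nu> i - pmf \<pi> i)" for \<nu>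
  note pert = perturbed_chain[OF Q Q' chain' inv_\<pi> \<delta> lam less_imp_le[OF b] drift,
      folded \<Delta> p_def E_def, folded D_def x_def]
  have p_le: "p \<le> ennreal (b / lam)" by (rule pert(1))
  then have p_fin: "p < \<top>" by (rule le_less_trans) simp
  have "E < \<top>"
    unfolding E_def using vector_norm_one_le[OF \<delta>] by (rule le_less_trans) simp
  then have c_fin: "1 + E * p < \<top>" using p_fin by (simp add: ennreal_mult_less_top)
  have part1: "positive_recurrent Q' P' \<Phi>' \<and>
      (\<exists>\<nu>. unique_invariant_prob Q' \<nu> \<and>
        x \<nu> \<le> (1 + E * p) * p * D / (ennreal lam - (1 + E * p) * D))"
    if small: "D < ennreal lam / (1 + E * p)"
  proof -
    \<comment> \<open>Finiteness of c provides a real representative, with which D < lam / c can be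
      multiplied out to c D < lam.\<close>
    obtain cr where cr_eq: "1 + E * p = ennreal cr" and cr_nonneg: "0 \<le> cr"
      using c_fin unfolding less_top_ennreal by blast
    have "ennreal 1 \<le> 1 + E * p" by simp
    then have "1 \<le> cr" unfolding cr_eq using cr_nonneg by (simp only: ennreal_le_iff)
    note cr = cr_eq this
    have "D < ennreal (lam / cr)"
      using small cr lam by (simp add: divide_ennreal)
    then obtain Dr where D: "D = ennreal Dr" "0 \<le> Dr" "Dr < lam / cr"
      by (cases D) (auto simp: ennreal_less_iff)
    have "(1 + E * p) * D < ennreal lam"
      using cr D lam by (simp add: ennreal_mult[symmetric] ennreal_less_iff field_simps)
    moreover have "D < \<top>" using D by simp
    ultimately show ?thesis
      using pert(2)[OF small] bound_from_fixed_point_inequality[OF _ _ p_fin c_fin _ _ lam, of "x _" D] by blast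
  qed
  have part2: "x \<nu> \<le> ennreal (b * (b + lam)) * D / (ennreal (lam ^ 3) - ennreal (lam * (b + lam)) * D)"
    if \<nu>: "unique_invariant_prob Q' \<nu>" and V1: "\<forall>i. 1 \<le> V i" and small: "D < ennreal (lam\<^sup>2 / (b + lam))" for \<nu>
  proof -
    \<comment> \<open>From \<open>V\<close> \<ge> 1 one has E \<le> 1, and p \<le> b / lam, so 1 + E
      p is at most this \<open>c\<close>. As lam^2 / (b + lam) = lam / c, the smallness condition
      here implies that of the first part.\<close>
    define c where "c = (b + lam) / lam"
    have c: "0 < c" using b lam by (simp add: c_def)
    obtain Dr where D: "D = ennreal Dr" "0 \<le> Dr" "Dr < lam\<^sup>2 / (b + lam)"
      using small b lam by (cases D) (auto simp: ennreal_less_iff)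
    have "E \<le> 1"
      unfolding E_def using vector_norm_one_le[of 1 V] V1 by simp
    then have "1 + E * p \<le> 1 + 1 * ennreal (b / lam)"
      using p_le by (intro add_left_mono mult_mono) auto
    also have "\<dots> = ennreal c"
      using b lam ennreal_plus[of 1 "b / lam"] by (simp add: c_def add_divide_distrib add.commute)
    finally have c_le: "1 + E * p \<le> ennreal c" .
    have lam_c: "lam\<^sup>2 / (b + lam) = lam / c"
      using b lam by (simp add: c_def power2_eq_square)
    have "D < ennreal lam / ennreal c"
      using small c lam by (simp add: lam_c divide_ennreal)
    also have "\<dots> \<le> ennreal lam / (1 + E * p)"
      by (rule ennreal_divide_left_mono[OF c_le])
    finally obtain \<nu>' where \<nu>': "unique_invariant_prob Q' \<nu>'" and fin: "x \<nu>' < \<top>"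
      and le: "ennreal lam * x \<nu>' \<le> (1 + E * p) * (D * (x \<nu>' + p))"
      using pert(2) by blast
    \<comment> \<open>The core lemma yields some invariant measure; uniqueness identifies it with
      the given one.\<close>
    have [simp]: "\<nu>' = \<nu>" using \<nu> \<nu>' by (simp add: unique_invariant_prob_def)
    have "(1 + E * p) * (D * (x \<nu> + p)) \<le> ennreal c * (D * (x \<nu> + ennreal (b / lam)))"
      by (intro mult_mono add_left_mono c_le p_le) auto
    with le have "ennreal lam * x \<nu> \<le> ennreal c * (D * (x \<nu> + ennreal (b / lam)))" by simp
    moreover have cD: "c * Dr < lam"
      using D(3) c unfolding lam_c by (simp add: field_simps)
    then have "ennreal c * D < ennreal lam"
      using c D lam by (simp add: ennreal_mult[symmetric] ennreal_less_iff)
    ultimately have "x \<nu> \<le> ennreal c * ennreal (b / lam) * D / (ennreal lam - ennreal c * D)"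
      using fin D(1) lam by (intro bound_from_fixed_point_inequality) auto
    also have "\<dots> = ennreal (c * (b / lam) * Dr / (lam - c * Dr))"
      using cD c b lam D by (simp add: ennreal_mult[symmetric] ennreal_minus divide_ennreal)
    \<comment> \<open>Numerator and denominator are both multiplied by lam^2.\<close>
    also have "c * (b / lam) * Dr / (lam - c * Dr) = b * (b + lam) * Dr / (lam ^ 3 - lam * (b + lam) * Dr)"
    proof -
      have "lam ^ 3 - lam * (b + lam) * Dr = lam\<^sup>2 * (lam - c * Dr)"
        using lam by (simp add: c_def power3_eq_cube power2_eq_square field_simps)
      moreover have "b * (b + lam) * Dr = lam\<^sup>2 * (c * (b / lam) * Dr)"
        using lam by (simp add: c_def power2_eq_square)
      ultimately show ?thesis using lam by simp
    qed
    also have "ennreal \<dots> = ennreal (b * (b + lam)) * D / (ennreal (lam ^ 3) - ennreal (lam * (b + lam)) * D)"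
    proof -
      have "lam * (b + lam) * Dr < lam ^ 3"
      proof -
        have "(b + lam) * Dr < lam\<^sup>2"
          using D(3) b lam by (simp add: field_simps)
        then show ?thesis using lam by (simp add: power3_eq_cube power2_eq_square mult.assoc)
      qed
      then show ?thesis
        using D b lam by (simp add: ennreal_mult[symmetric] ennreal_minus divide_ennreal)
    qed
    finally show ?thesis .
  qed
  show ?thesis
    unfolding Let_def using part1 part2 unfolding p_def E_def D_def x_def by blast
qed

end
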